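(* Suppose that $E(w(1)+w(2))=1$ and $\sum_{i\in S}P(w(i)=1)<1$. For $x,y\in T$ define $R(x,y):=\lim_{n\to\infty}R^*(x_n,y_n)$, where $(x_n)$, $(y_n)$ are sequences in $V^*$ converging to $x$ and $y$ respectively in the Euclidean metric. Then, $P$-a.s., $R$ is a well-defined metric on $T$ (i.e. the limit exists and does not depend on the choice of approximating sequences, and the resulting function is a metric), and $R$ is topologically equivalent to the Euclidean metric on $T$ (i.e. the two metrics induce the same topology).
   Context: Addresses: $S:=\{1,2,3\}$; $\Sigma_n:=S^n$ (with $\Sigma_0:=\{\emptyset\}$), $\Sigma_*:=\bigcup_{n\ge0}\Sigma_n$; $ij$ denotes concatenation, $|i|$ the length of $i\in\Sigma_*$, and $i|m$ the truncation of $i$ to its first $m$ letters. Fractal: fix $c\in(0,1/2)$ and maps on $\mathbb{R}^2$: $\psi_1(x,y)=\frac12(1-x,y)$, $\psi_2(x,y)=\frac12(1+x,-y)$, $\psi_3(x,y)=(\frac12+cy,cx)$. $T$ is the unique non-empty compact subset of $\mathbb{R}^2$ with $T=\bigcup_{i\in S}\psi_i(T)$. For $i\in\Sigma_n$, $\psi_i:=\psi_{i_1}\circ\dots\circ\psi_{i_n}$ ($\psi_\emptyset$ is the identity). $V^0:=\{(0,0),(1,0)\}$, $V^n:=\bigcup_{i\in\Sigma_n}\psi_i(V^0)$, $V^*:=\bigcup_{n\ge0}V^n$. $T$ is the Euclidean closure of $V^*$. Cascade: $(w(i))_{i\in\Sigma_*\setminus\{\emptyset\}}$ are random variables on a probability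 space with measure $P$ (expectation $E$), with values in $[0,1]$ and non-zero $P$-a.s., such that the triples $(w(ij))_{j\in S}$, $i\in\Sigma_*$, are independent copies of $(w(j))_{j\in S}$ (no independence is assumed within a triple). $l(\emptyset):=1$, $l(i):=w(i|1)w(i|2)\cdots w(i)$. Under the condition $E(w(1)+w(2))=1$, the limits $R_i:=\lim_{n\to\infty}\sum_{j\in\{1,2\}^n}l(ij)/l(i)$, $i\in\Sigma_*$, exist in $(0,\infty)$ $P$-a.s. Metric on $V^*$: for $f:V^n\to\mathbb{R}$ let $\mathcal{E}^n(f,f):=\sum_{i\in\Sigma_n}\frac{1}{l(i)R_i}\left(f(\psi_i(0,0))-f(\psi_i(1,0))\right)^2$. For $f:V^*\to\mathbb{R}$ let $\mathcal{E}^*(f,f):=\lim_{n\to\infty}\mathcal{E}^n(f|_{V^n},f|_{V^n})$, with domain $\mathcal{F}^*$ the set of $f$ for which this limit exists finitely. Define $R^*(x,x)=0$ and, for $x\ne y$ in $V^*$, $R^*(x,y)^{-1}:=\inf\{\mathcal{E}^*(f,f): f\in\mathcal{F}^*, f(x)=0, f(y)=1\}$; under $E(w(1)+w(2))=1$ this is $P$-a.s. a metric on $V^*$ (the resistance metric). *)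

theory Defs
  imports "HOL-Probability.Probability"
begin

abbreviation letters :: "nat set" where
  "letters \<equiv> {1, 2, 3}"

definition words :: "nat set \<Rightarrow> nat \<Rightarrow> nat list set" where
  "words A n = {i \<in> lists A. length i = n}"

fun psi :: "real \<Rightarrow> nat \<Rightarrow> real \<times> real \<Rightarrow> real \<times> real" where
  "psi c i (x, y) =
    (if i = 1 then ((1 - x) / 2, y / 2)
     else if i = 2 then ((1 + x) / 2, - y / 2)
     else (1 / 2 + c * y, c * x))"

definition psi_word :: "real \<Rightarrow> nat list \<Rightarrow> real \<times> real \<Rightarrow> real \<times> real" where
  "psi_word c i = foldr (psi c) i"

definition vertices :: "real \<Rightarrow> nat \<Rightarrow> (real \<times> real) set" where
  "vertices c n = (\<Union>i \<in> words letters n. psi_word c i ` {(0, 0), (1, 0)})"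

definition all_vertices :: "real \<Rightarrow> (real \<times> real) set" where
  "all_vertices c = (\<Union>n. vertices c n)"

(* In what follows v :: nat list => real is one realisation i |-> w(i)(omega) of the cascade. *)

definition edge_length :: "(nat list \<Rightarrow> real) \<Rightarrow> nat list \<Rightarrow> real" where
  "edge_length v i = (\<Prod>k = 1..length i. v (take k i))"

definition cascade_limit :: "(nat list \<Rightarrow> real) \<Rightarrow> nat list \<Rightarrow> real" where
  "cascade_limit v i =
    lim (\<lambda>n. \<Sum>j \<in> words {1, 2} n. edge_length v (i @ j) / edge_length v i)"

(* Functions on V^n and V^* are represented by total functions on the plane: only their values
   on V^n, respectively V^*, enter the energies. *)

definition energy ::
    "real \<Rightarrow> (nat list \<Rightarrow> real) \<Rightarrow> nat \<Rightarrow> (real \<times> real \<Rightarrow> real) \<Rightarrow> real" where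
  "energy c v n f =
    (\<Sum>i \<in> words letters n. 1 / (edge_length v i * cascade_limit v i) *
       (f (psi_word c i (0, 0)) - f (psi_word c i (1, 0)))\<^sup>2)"

definition energy_domain ::
    "real \<Rightarrow> (nat list \<Rightarrow> real) \<Rightarrow> (real \<times> real \<Rightarrow> real) set" where
  "energy_domain c v = {f. convergent (\<lambda>n. energy c v n f)}"

definition energy_limit ::
    "real \<Rightarrow> (nat list \<Rightarrow> real) \<Rightarrow> (real \<times> real \<Rightarrow> real) \<Rightarrow> real" where
  "energy_limit c v f = lim (\<lambda>n. energy c v n f)"

(* Real-valued; division by zero would stand for infinite resistance, so a zero infimum yields
   resistance 0 between distinct points, which is not a metric. *)
definition resistance ::
    "real \<Rightarrow> (nat list \<Rightarrow> real) \<Rightarrow> real \<times> real \<Rightarrow> real \<times> real \<Rightarrow> real" where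
  "resistance c v x y =
    (if x = y then 0
     else 1 / (INF f \<in> {f \<in> energy_domain c v. f x = 0 \<and> f y = 1}. energy_limit c v f))"

definition is_resistance_limit ::
    "real \<Rightarrow> (nat list \<Rightarrow> real) \<Rightarrow> real \<times> real \<Rightarrow> real \<times> real \<Rightarrow> real \<Rightarrow> bool" where
  "is_resistance_limit c v x y r \<longleftrightarrow>
    (\<forall>xs ys. range xs \<subseteq> all_vertices c \<and> range ys \<subseteq> all_vertices c
       \<and> xs \<longlonglongrightarrow> x \<and> ys \<longlonglongrightarrow> y
       \<longrightarrow> (\<lambda>n. resistance c v (xs n) (ys n)) \<longlonglongrightarrow> r)"

(* The value 0 off T is a convention: the locale Metric_space asks for symmetry and
   nonnegativity on the whole type. *)
definition limit_resistance ::
    "real \<Rightarrow> (nat list \<Rightarrow> real) \<Rightarrow> (real \<times> real) set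
       \<Rightarrow> real \<times> real \<Rightarrow> real \<times> real \<Rightarrow> real" where
  "limit_resistance c v T x y =
    (if x \<in> T \<and> y \<in> T then THE r. is_resistance_limit c v x y r else 0)"

end

theory Submission imports Defs begin

text \<open>The graphs on V^n are trees: each edge is replaced in the next step by three edges that meet
  in a new centre, and R(i) = w(i1) R(i1) + w(i2) R(i2) makes their edge resistances l(i) R(i)
  compatible. Hence the resistance on V^* is the path distance for these edge lengths. If the edge
  lengths of level n are at most C r^n with r < 1, then cells have vanishing resistance diameter, so
  the resistance is uniformly continuous for the Euclidean metric and extends to the closure of V^*;
  points in disjoint cells stay at least an edge apart, so the extension is positive off the
  diagonal, and compactness identifies the two topologies.

  The geometric bound comes from moments. R(i) has moments of all orders because
  E(w(1)^p + w(2)^p) < 1 for p > 1, and E(w(1)^p + w(2)^p + w(3)^p) tends to the sum of the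
  probabilities P(w(i) = 1), which is less than 1. So for large p the expected sum of the p-th powers
  of the edge lengths of level n decays geometrically in n.\<close>

section \<open>Cells of the dendrite\<close>

text \<open>Two obstacles shape the proof. Points that are close in the plane need not lie in one
  cell; the rhombus, invariant under all three maps, repairs this, since cells of equal level meet
  only if they share a vertex, and a path can change cells there. On the probabilistic side no
  almost sure bound on \<open>cascade_limit\<close> uniform over addresses is at hand, so the decay
  of the weights cannot be read off from \<open>edge_length\<close> alone. A single weight is
  therefore bounded by the sum of p-th powers over its whole level, whose mean is controlled by
  linearity over the three children and by independence of a triple from the subtrees below it.
  E(w(1)^2 + w(2)^2) < 1 rests on the weights being nonzero: equality would force both weights to be
  1 almost surely, against the mean 1 of their sum. Positivity of R(i), without which the
  conductances make no sense, starts from a second moment bound uniform in i and is amplified by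
  independence. Convergence to R(i) comes from geometrically small L2 increments.\<close>

declare psi.simps [simp del]

section \<open>Words and the vertices they address\<close>

lemma words_0 [simp]: "words A 0 = {[]}"
  by (auto simp: words_def)

lemma words_Suc: "words A (Suc n) = (\<lambda>(k, i). k # i) ` (A \<times> words A n)"
  by (auto simp: words_def image_iff length_Suc_conv)

lemma UN_words_Suc: "(\<Union>i\<in>words A (Suc n). F i) = (\<Union>k\<in>A. \<Union>i\<in>words A n. F (k # i))"
  by (auto simp: words_Suc)

lemma words_Suc_snoc: "words A (Suc n) = (\<lambda>(i, k). i @ [k]) ` (words A n \<times> A)"
proof
  show "words A (Suc n) \<subseteq> (\<lambda>(i, k). i @ [k]) ` (words A n \<times> A)"
  proof
    fix i assume i: "i \<in> words A (Suc n)"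
    then have "i \<noteq> []" by (auto simp: words_def)
    then have "i = butlast i @ [last i]" by simp
    moreover have "butlast i \<in> words A n" "last i \<in> A"
      using i \<open>i \<noteq> []\<close> by (auto simp: words_def in_lists_conv_set dest: in_set_butlastD)
    ultimately show "i \<in> (\<lambda>(i, k). i @ [k]) ` (words A n \<times> A)"
      by (metis (no_types, lifting) SigmaI case_prod_conv image_eqI)
  qed
qed (auto simp: words_def)

lemma finite_words [simp]: "finite A \<Longrightarrow> finite (words A n)"
  by (induction n) (auto simp: words_Suc)

lemma sum_words_Suc:
  "(\<Sum>i\<in>words A (Suc n). F i) = (\<Sum>k\<in>A. \<Sum>i\<in>words A n. F (k # i))"
proof -
  have "(\<Sum>i\<in>words A (Suc n). F i) = (\<Sum>(k, i)\<in>A \<times> words A n. F (k # i))"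
    unfolding words_Suc by (subst sum.reindex) (auto simp: inj_on_def case_prod_unfold)
  then show ?thesis by (simp add: sum.cartesian_product)
qed

lemma sum_words_Suc_snoc:
  "(\<Sum>i\<in>words A (Suc n). F i) = (\<Sum>i\<in>words A n. \<Sum>k\<in>A. F (i @ [k]))"
proof -
  have "(\<Sum>i\<in>words A (Suc n). F i) = (\<Sum>(i, k)\<in>words A n \<times> A. F (i @ [k]))"
    unfolding words_Suc_snoc by (subst sum.reindex) (auto simp: inj_on_def case_prod_unfold)
  then show ?thesis by (simp add: sum.cartesian_product)
qed

lemma psi_word_Nil [simp]: "psi_word c [] p = p"
  and psi_word_Cons [simp]: "psi_word c (k # i) p = psi c k (psi_word c i p)"
  and psi_word_append: "psi_word c (i @ j) p = psi_word c i (psi_word c j p)"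
  by (simp_all add: psi_word_def)

lemma psi_word_Cons_image: "psi_word c (k # i) ` A = psi c k ` psi_word c i ` A"
  by (simp add: image_image)

lemma vertices_0: "vertices c 0 = {(0, 0), (1, 0)}"
  by (auto simp: vertices_def)

lemma vertices_Suc: "vertices c (Suc n) = (\<Union>k\<in>letters. psi c k ` vertices c n)"
  unfolding vertices_def UN_words_Suc psi_word_Cons_image image_UN ..

section \<open>An invariant rhombus and the intersections of its images\<close>

locale dendrite =
  fixes c :: real
  assumes c_pos: "0 < c" and c_less: "c < 1 / 2"
begin

text \<open>As c < 1/2, the three images of this set lie in it and meet only in the centre (1/2, 0).\<close>

definition rhombus :: "(real \<times> real) set" where
  "rhombus = {p. \<bar>snd p\<bar> \<le> 2 * c * fst p \<and> \<bar>snd p\<bar> \<le> 2 * c * (1 - fst p)}"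

fun psi_inv :: "nat \<Rightarrow> real \<times> real \<Rightarrow> real \<times> real" where
  "psi_inv i (x, y) =
    (if i = 1 then (1 - 2 * x, 2 * y)
     else if i = 2 then (2 * x - 1, - 2 * y)
     else (y / c, (x - 1 / 2) / c))"

lemma psi_inv_psi [simp]: "psi_inv k (psi c k p) = p"
  using c_pos by (cases p) (auto simp: psi.simps field_simps)

lemma psi_psi_inv: "psi c k (psi_inv k p) = p"
  using c_pos by (cases p) (auto simp: psi.simps field_simps)

lemma psi_inj: "psi c k p = psi c k q \<Longrightarrow> p = q"
  by (metis psi_inv_psi)

lemma rhombus_bounds:
  assumes "(x, y) \<in> rhombus"
  shows "0 \<le> x" "x \<le> 1" "\<bar>y\<bar> \<le> 2 * c * x" "\<bar>y\<bar> \<le> 2 * c * (1 - x)" "\<bar>y\<bar> \<le> 1" "2 * c * \<bar>y\<bar> \<le> \<bar>y\<bar>"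
proof -
  show 1: "\<bar>y\<bar> \<le> 2 * c * x" "\<bar>y\<bar> \<le> 2 * c * (1 - x)"
    using assms by (auto simp: rhombus_def)
  have "0 \<le> 2 * c * x" "0 \<le> 2 * c * (1 - x)" using 1 by linarith+
  then show 2: "0 \<le> x" "x \<le> 1" using c_pos by (auto simp: zero_le_mult_iff)
  have "2 * c * x \<le> 1 * 1"
    using 2 c_less c_pos by (intro mult_mono) auto
  then show "\<bar>y\<bar> \<le> 1" using 1 by linarith
  show "2 * c * \<bar>y\<bar> \<le> \<bar>y\<bar>"
    using c_less by (intro mult_left_le_one_le[where 'a=real, of "\<bar>y\<bar>" "2*c"]) (use c_pos in auto)
qed

lemma psi_rhombus:
  assumes "p \<in> rhombus" shows "psi c k p \<in> rhombus"
proof -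
  obtain x y where p: "p = (x, y)" by force
  note b = rhombus_bounds[OF assms[unfolded p]]
  have cx: "0 \<le> c * x" "c * x \<le> c" using b c_pos by (auto simp: mult_left_le)
  \<comment> \<open>The third image asks for \<open>x \<le> 1 + 2 * c * y\<close> and
    \<open>x \<le> 1 - 2 * c * y\<close>. The bound
    \<open>\<bar>y\<bar> \<le> 2 * c * (1 - x)\<close> gives both, since the factor
    \<open>2 * c\<close> is below 1.\<close>
  have "2 * c * (1 - x) \<le> 1 * (1 - x)" using b c_less by (intro mult_right_mono) auto
  with b(4) have "\<bar>y\<bar> \<le> 1 * (1 - x)" by (rule order_trans)
  with b(6) have "2 * c * \<bar>y\<bar> \<le> 1 - x" by simp
  then have "\<bar>2 * c * y\<bar> \<le> 1 - x" using c_pos by (simp add: abs_mult)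
  then have "x \<le> 1 + 2 * c * y" "x \<le> 1 - 2 * c * y" by linarith+
  then have "c * x \<le> c * (1 + 2 * c * y)" "c * x \<le> c * (1 - 2 * c * y)"
    using c_pos by (auto intro!: mult_left_mono)
  then show ?thesis
    using b cx c_pos unfolding rhombus_def p
    by (auto simp: psi.simps algebra_simps abs_mult add_divide_distrib diff_divide_distrib)
qed

text \<open>Around the centre \<open>(1 / 2, 0)\<close> the images under 1 and 2 lie on opposite
  sides of the vertical line, in the double cone of slope \<open>2 * c\<close> about the horizontal
  axis. The image under 3 lies in the corresponding cone about the vertical axis. Since
  \<open>2 * c < 1\<close>, these cones meet only in the centre, whose preimage under each map is
  \<open>(0, 0)\<close>.\<close>

lemma psi_eq_psi:
  assumes "p \<in> rhombus" "q \<in> rhombus" "k \<in> letters" "l \<in> letters" "k \<noteq> l" "psi c k p = psi c l q"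
  shows "p = (0, 0) \<and> q = (0, 0)"
proof -
  have *: "p = (0, 0) \<and> q = (0, 0)"
    if p: "p \<in> rhombus" and q: "q \<in> rhombus" and kl: "k < l" and k: "k \<in> letters" and l: "l \<in> letters"
      and eq: "psi c k p = psi c l q" for p q k l
  proof -
    obtain x y u v where pq: "p = (x, y)" "q = (u, v)" by force
    note bp = rhombus_bounds[OF p[unfolded pq]] and bq = rhombus_bounds[OF q[unfolded pq]]
    consider "k = 1" "l = 2" | "k \<in> {1, 2}" "l = 3" using k l kl by auto
    then show ?thesis
    proof cases
      case 1
      then have "x = 0" "u = 0" using eq bp bq by (auto simp: pq psi.simps)
      then show ?thesis using bp bq pq by auto
    next
      case 2
      have xv: "x \<le> 2 * c * \<bar>v\<bar> \<and> \<bar>y\<bar> = 2 * c * u"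
      proof -
        have "2 * c * v \<le> 2 * c * \<bar>v\<bar>" "- (2 * c * v) \<le> 2 * c * \<bar>v\<bar>"
          using c_pos abs_ge_minus_self[of "2 * c * v"] by (auto simp: abs_mult)
        moreover have "0 \<le> c * u" using bq c_pos by auto
        ultimately show ?thesis
          using 2 eq by (auto simp: pq psi.simps abs_if field_simps split: if_splits)
      qed
      \<comment> \<open>The circle \<open>u \<le> x \<le> \<bar>v\<bar> \<le> 2 * c * u\<close>
        closes, and strictness of \<open>c < 1 / 2\<close> leaves only \<open>u = 0\<close>.\<close>
      have "2 * c * u \<le> 2 * c * x" using xv bp by auto
      then have "u \<le> x" using c_pos by auto
      also have "x \<le> \<bar>v\<bar>" using xv bq by linarith
      also have "\<bar>v\<bar> \<le> 2 * c * u" by fact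
      finally have "u \<le> 2 * c * u" .
      then have "(1 - 2 * c) * u \<le> 0" by (simp add: algebra_simps)
      then have "u = 0" using bq c_less by (simp add: mult_le_0_iff)
      then show ?thesis using bq bp xv by (auto simp: pq)
    qed
  qed
  show ?thesis
  proof (cases "k < l")
    case True then show ?thesis using *[OF assms(1,2) True] assms by auto
  next
    case False then have "l < k" using assms by auto
    from *[OF assms(2,1) this] show ?thesis using assms by auto
  qed
qed

lemma ends_in_rhombus [simp]: "(0, 0) \<in> rhombus" "(1, 0) \<in> rhombus"
  using c_pos by (auto simp: rhombus_def)

lemma psi_word_rhombus: "p \<in> rhombus \<Longrightarrow> psi_word c i p \<in> rhombus"
  by (induction i) (auto intro: psi_rhombus)

lemma vertices_rhombus: "p \<in> vertices c n \<Longrightarrow> p \<in> rhombus"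
  by (auto simp: vertices_def intro!: psi_word_rhombus)

lemma psi_centre: "psi c k (0, 0) = (1 / 2, 0)"
  by (simp add: psi.simps)

lemma psi_ends: "psi c 1 (1, 0) = (0, 0)" "psi c 2 (1, 0) = (1, 0)"
  by (simp_all add: psi.simps)

lemma psi_vertices: "k \<in> letters \<Longrightarrow> p \<in> vertices c n \<Longrightarrow> psi c k p \<in> vertices c (Suc n)"
  by (auto simp: vertices_Suc)

lemma vertices_Suc_mono: "vertices c n \<subseteq> vertices c (Suc n)"
proof (induction n)
  case 0
  have "psi c 1 (1, 0) \<in> vertices c (Suc 0)" "psi c 2 (1, 0) \<in> vertices c (Suc 0)"
    by (rule psi_vertices; simp add: vertices_0)+
  then show ?case unfolding psi_ends by (simp add: vertices_0)
next
  case (Suc n)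
  show ?case
    by (subst (1 2) vertices_Suc) (use Suc in blast)
qed

lemma vertices_mono: "m \<le> n \<Longrightarrow> vertices c m \<subseteq> vertices c n"
  by (rule lift_Suc_mono_le[of "vertices c"]) (use vertices_Suc_mono in auto)

lemma ends_in_vertices [simp]: "(0, 0) \<in> vertices c n" "(1, 0) \<in> vertices c n"
  using vertices_mono[of 0 n] by (auto simp: vertices_0)

lemma psi_word_vertices:
  "i \<in> lists letters \<Longrightarrow> p \<in> vertices c n \<Longrightarrow> psi_word c i p \<in> vertices c (length i + n)"
  by (induction i) (auto intro!: psi_vertices)

lemma vertices_add:
  "vertices c (m + n) = (\<Union>i\<in>words letters m. psi_word c i ` vertices c n)"
proof (induction m)
  case (Suc m)
  have "vertices c (Suc m + n) = (\<Union>k\<in>letters. \<Union>i\<in>words letters m. psi c k ` psi_word c i ` vertices c n)"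
    unfolding add_Suc vertices_Suc Suc image_UN ..
  also have "\<dots> = (\<Union>i\<in>words letters (Suc m). psi_word c i ` vertices c n)"
    unfolding UN_words_Suc psi_word_Cons_image ..
  finally show ?case .
qed simp

section \<open>Contraction, contact and separation of cells\<close>

lemma dist_psi: "dist (psi c k p) (psi c k q) \<le> dist p q / 2"
proof -
  obtain x y u v where pq: "p = (x, y)" "q = (u, v)" by force
  have eq: "dist (psi c k p) (psi c k q) = (if k = 1 \<or> k = 2 then 1 / 2 else c) * dist p q"
  proof -
    define a where "a = (if k = 1 \<or> k = 2 then 1 / 2 else c)"
    have "dist (psi c k p) (psi c k q) = sqrt (a^2 * ((x - u)^2 + (y - v)^2))"
      unfolding pq a_def by (simp add: psi.simps dist_Pair_Pair dist_real_def power2_eq_square)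
        (auto intro!: arg_cong[where f = sqrt] simp: field_simps)
    also have "\<dots> = a * dist p q"
      unfolding pq real_sqrt_mult by (use c_pos in \<open>simp add: a_def dist_Pair_Pair dist_real_def\<close>)
    finally show ?thesis by (simp add: a_def)
  qed
  have "(if k = 1 \<or> k = 2 then 1 / 2 else c) * dist p q \<le> 1 / 2 * dist p q"
    using c_less by (intro mult_right_mono) auto
  then show ?thesis using eq by simp
qed

lemma dist_psi_word: "dist (psi_word c i p) (psi_word c i q) \<le> dist p q / 2 ^ length i"
proof (induction i)
  case (Cons k i)
  show ?case
    using dist_psi[of k "psi_word c i p" "psi_word c i q"] Cons by simp
qed simp

lemma continuous_psi_word: "continuous_on A (psi_word c i)"
proof (rule continuous_onI)
  fix x e assume e: "(e::real) > 0"
  show "\<exists>d>0. \<forall>x'\<in>A. dist x' x < d \<longrightarrow> dist (psi_word c i x') (psi_word c i x) \<le> e"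
  proof (intro exI conjI ballI impI)
    fix x' assume "dist x' x < e"
    have "dist (psi_word c i x') (psi_word c i x) \<le> dist x' x / 2 ^ length i"
      by (rule dist_psi_word)
    also have "\<dots> \<le> dist x' x / 1" by (intro divide_left_mono) auto
    finally show "dist (psi_word c i x') (psi_word c i x) \<le> e" using \<open>dist x' x < e\<close> by simp
  qed (rule e)
qed

lemma compact_rhombus: "compact rhombus"
proof -
  have "rhombus \<subseteq> {0..1} \<times> {-1..1}"
    using rhombus_bounds(1,2,5) by (force simp: abs_le_iff)
  then have "bounded rhombus"
    by (rule bounded_subset[rotated]) (intro bounded_Times bounded_closed_interval)
  moreover have "closed rhombus"
    unfolding rhombus_def by (intro closed_Collect_conj closed_Collect_le continuous_intros)
  ultimately show ?thesis by (simp add: compact_eq_bounded_closed)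
qed

lemma compact_cell: "compact (psi_word c i ` rhombus)"
  by (intro compact_continuous_image continuous_psi_word compact_rhombus)

text \<open>Inside the rhombus an end of V^0 has no preimage but \<open>(1, 0)\<close>, and that
  only through letter 1 or 2: letter 3 moves the first coordinate to \<open>1 / 2 + c * y\<close>
  with \<open>\<bar>c * y\<bar> < 1 / 2\<close>. So the induction continues with the end
  \<open>(1, 0)\<close> of the shorter word.\<close>

lemma end_in_cell:
  assumes "i \<in> lists letters" "p \<in> vertices c 0" "p \<in> psi_word c i ` rhombus"
  shows "p \<in> psi_word c i ` vertices c 0"
  using assms
proof (induction i arbitrary: p rule: list.induct)
  case (Cons k i)
  obtain q where q: "q \<in> psi_word c i ` rhombus" "p = psi c k q"
    using Cons.prems(3) unfolding psi_word_Cons_image by blast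
  obtain x y where xy: "q = (x, y)" by force
  have "q \<in> rhombus" using q psi_word_rhombus by auto
  note b = rhombus_bounds[OF this[unfolded xy]]
  have "q = (1, 0)"
  proof (cases "k = 1 \<or> k = 2")
    case True
    then show ?thesis using Cons.prems q b by (auto simp: xy vertices_0 psi.simps)
  next
    case False
    have "\<bar>c * y\<bar> < 1 / 2"
      using b c_pos c_less by (auto simp: abs_mult) (smt (verit) mult_right_le_one_le)
    then show ?thesis using False Cons.prems(2) q by (auto simp: xy vertices_0 psi.simps)
  qed
  then have "q \<in> psi_word c i ` vertices c 0"
    using Cons q by (auto simp: vertices_0)
  then show ?case using q by auto
qed auto

text \<open>At the first letter where the words differ, the images meet only in the centre. Both
  remaining cells then contain \<open>(0, 0)\<close>, which is a vertex of each by
  \<open>end_in_cell\<close>. A common vertex is what lets a tree path pass from one cell to the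
  other.\<close>

lemma touching_cells:
  assumes "i \<in> lists letters" "j \<in> lists letters" "length i = length j"
    and "psi_word c i ` rhombus \<inter> psi_word c j ` rhombus \<noteq> {}"
  shows "psi_word c i ` vertices c 0 \<inter> psi_word c j ` vertices c 0 \<noteq> {}"
  using assms
proof (induction i arbitrary: j rule: list.induct)
  case (Cons k i)
  obtain l j' where j: "j = l # j'" using Cons.prems by (cases j) auto
  obtain p q where pq: "p \<in> psi_word c i ` rhombus" "q \<in> psi_word c j' ` rhombus"
    "psi c k p = psi c l q"
    using Cons.prems(4) unfolding j psi_word_Cons_image by blast
  show ?case
  proof (cases "k = l")
    case True
    then have "p = q" using pq psi_inj by auto
    then have "psi_word c i ` vertices c 0 \<inter> psi_word c j' ` vertices c 0 \<noteq> {}"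
      using Cons j pq by auto
    then obtain r where "r \<in> psi_word c i ` vertices c 0" "r \<in> psi_word c j' ` vertices c 0"
      by blast
    then have "psi c k r \<in> psi_word c (k # i) ` vertices c 0 \<inter> psi_word c j ` vertices c 0"
      using True by (auto simp: j)
    then show ?thesis by blast
  next
    case False
    have "p \<in> rhombus" "q \<in> rhombus" using pq psi_word_rhombus by auto
    then have "p = (0, 0)" "q = (0, 0)"
      using psi_eq_psi[of p q k l] pq False Cons.prems by (auto simp: j)
    then have "p \<in> psi_word c i ` vertices c 0" "q \<in> psi_word c j' ` vertices c 0"
      using end_in_cell[of i p] end_in_cell[of j' q] pq Cons.prems by (auto simp: j vertices_0)
    then have "psi c k p \<in> psi_word c (k # i) ` vertices c 0"
      "psi c l q \<in> psi_word c j ` vertices c 0"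
      unfolding j psi_word_Cons_image by (blast intro: imageI)+
    then have "psi c k p \<in> psi_word c (k # i) ` vertices c 0 \<inter> psi_word c j ` vertices c 0"
      using pq(3) by simp
    then show ?thesis by blast
  qed
qed (auto simp: vertices_0)

text \<open>At a fixed level there are finitely many pairs of compact cells, and disjoint ones have
  positive distance. The lemma is used in the form that sufficiently close points lie in cells that
  meet.\<close>

lemma cells_separated:
  shows "\<exists>e>0. \<forall>i\<in>words letters n. \<forall>j\<in>words letters n. \<forall>x\<in>psi_word c i ` rhombus.
    \<forall>y\<in>psi_word c j ` rhombus. dist x y < e \<longrightarrow>
      psi_word c i ` rhombus \<inter> psi_word c j ` rhombus \<noteq> {}"
proof -
  let ?W = "words letters n \<times> words letters n"
  have "\<exists>e>0. \<forall>x\<in>psi_word c i ` rhombus. \<forall>y\<in>psi_word c j ` rhombus. dist x y < e \<longrightarrow>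
      psi_word c i ` rhombus \<inter> psi_word c j ` rhombus \<noteq> {}" for i j
  proof (cases "psi_word c i ` rhombus \<inter> psi_word c j ` rhombus = {}")
    case True
    obtain d where "0 < d" "\<forall>x\<in>psi_word c i ` rhombus. \<forall>y\<in>psi_word c j ` rhombus. d \<le> dist x y"
      using separate_compact_closed[OF compact_cell compact_imp_closed[OF compact_cell] True] by blast
    then show ?thesis by (intro exI[of _ d]) (auto simp: not_less[symmetric])
  qed (auto intro: exI[of _ 1])
  then obtain e where e: "\<And>i j. e i j > 0" "\<And>i j x y. x \<in> psi_word c i ` rhombus \<Longrightarrow>
     y \<in> psi_word c j ` rhombus \<Longrightarrow> dist x y < e i j \<Longrightarrow>
      psi_word c i ` rhombus \<inter> psi_word c j ` rhombus \<noteq> {}" by metis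
  define d where "d = Min (insert 1 ((\<lambda>(i, j). e i j) ` ?W))"
  have fin: "finite (insert 1 ((\<lambda>(i, j). e i j) ` ?W))" by simp
  have "d > 0" unfolding d_def using fin e(1) by (subst Min_gr_iff) auto
  moreover have "d \<le> e i j" if "(i, j) \<in> ?W" for i j
    unfolding d_def using fin that by (intro Min_le) auto
  ultimately have d: "d > 0" "\<And>i j. i \<in> words letters n \<Longrightarrow> j \<in> words letters n \<Longrightarrow> d \<le> e i j"
    by blast+
  show ?thesis
  proof (intro exI[of _ d] conjI ballI impI)
    fix i j x y
    assume "i \<in> words letters n" "j \<in> words letters n"
      and x: "x \<in> psi_word c i ` rhombus" and y: "y \<in> psi_word c j ` rhombus" and "dist x y < d"
    then have "dist x y < e i j" by (intro order.strict_trans2[OF _ d(2)])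
    then show "psi_word c i ` rhombus \<inter> psi_word c j ` rhombus \<noteq> {}"
      by (rule e(2)[OF x y])
  qed (rule d)
qed

end

section \<open>The resistance as a tree distance\<close>

context dendrite begin

text \<open>For a vertex p of level n and a word j of length n, this is 0 or 1 according to the side of the
  edge j on which p lies, 0 being the side of the end psi(j)(0,0). It is junk for vertices of higher
  level.\<close>

fun side :: "nat list \<Rightarrow> real \<times> real \<Rightarrow> real" where
  "side [] p = fst p"
| "side (k # j) p = side j (if psi_inv k p \<in> rhombus then psi_inv k p else (0, 0))"

declare side.simps(2) [simp del]

lemma side_psi: "p \<in> rhombus \<Longrightarrow> side (k # j) (psi c k p) = side j p"
  by (simp add: side.simps(2))

text \<open>This is the reason for the default \<open>(0, 0)\<close> in \<open>side\<close>: seen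
  from the branch \<open>l\<close>, all of the branch \<open>k\<close> lies behind the centre, whose
  preimage is \<open>(0, 0)\<close>.\<close>

lemma side_psi_other:
  assumes "p \<in> rhombus" "k \<in> letters" "l \<in> letters" "k \<noteq> l"
  shows "side (l # j) (psi c k p) = side j (0, 0)"
proof (cases "psi_inv l (psi c k p) \<in> rhombus")
  case True
  have "psi c k p = psi c l (psi_inv l (psi c k p))" by (simp only: psi_psi_inv)
  then have "psi_inv l (psi c k p) = (0, 0)"
    using psi_eq_psi[OF assms(1) True assms(2-4)] by blast
  then show ?thesis by (simp add: side.simps(2))
qed (simp add: side.simps(2))

lemma side_psi_if:
  assumes "p \<in> rhombus" "k \<in> letters" "l \<in> letters"
  shows "side (l # j) (psi c k p) = side j (if l = k then p else (0, 0))"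
  using side_psi side_psi_other assms by auto

lemma side_01:
  "p \<in> vertices c n \<Longrightarrow> j \<in> words letters n \<Longrightarrow> side j p = 0 \<or> side j p = 1"
proof (induction n arbitrary: p j)
  case (Suc n)
  obtain k q where q: "p = psi c k q" "k \<in> letters" "q \<in> vertices c n"
    using Suc.prems(1) unfolding vertices_Suc by blast
  obtain l j' where j: "j = l # j'" "l \<in> letters" "j' \<in> words letters n"
    using Suc.prems(2) unfolding words_Suc by auto
  show ?case
    unfolding j q using side_psi_if[OF vertices_rhombus[OF q(3)] q(2) j(2)] Suc.IH j(3) q(3)
      ends_in_vertices(1)
    by presburger
qed (auto simp: vertices_0)

text \<open>Every edge is a bridge: the cut of \<open>j\<close> is crossed by the edge
  \<open>j\<close> and by no other. If the first letters differ, both ends of \<open>i\<close> look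
  like the centre from the branch of \<open>j\<close>.\<close>

lemma side_edge:
  "i \<in> words letters n \<Longrightarrow> j \<in> words letters n \<Longrightarrow>
    side j (psi_word c i (1, 0)) - side j (psi_word c i (0, 0)) = of_bool (j = i)"
proof (induction n arbitrary: i j)
  case (Suc n)
  obtain k i' where i: "i = k # i'" "k \<in> letters" "i' \<in> words letters n"
    using Suc.prems(1) unfolding words_Suc by auto
  obtain l j' where j: "j = l # j'" "l \<in> letters" "j' \<in> words letters n"
    using Suc.prems(2) unfolding words_Suc by auto
  show ?case
    unfolding i j psi_word_Cons
    by (subst (1 2) side_psi_if) (use i j Suc.IH[of i' j'] in \<open>auto intro!: psi_word_rhombus\<close>)
qed auto

lemma side_edge_ends:
  assumes "i \<in> words letters n"
  shows "side i (psi_word c i (1, 0)) = 1" "side i (psi_word c i (0, 0)) = 0"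
proof -
  have "psi_word c i p \<in> vertices c n" if "p \<in> {(0, 0), (1, 0)}" for p
    using assms that by (auto simp: vertices_def)
  then have "side i (psi_word c i (1, 0)) = 0 \<or> side i (psi_word c i (1, 0)) = 1"
    "side i (psi_word c i (0, 0)) = 0 \<or> side i (psi_word c i (0, 0)) = 1"
    using side_01 assms by blast+
  then show "side i (psi_word c i (1, 0)) = 1" "side i (psi_word c i (0, 0)) = 0"
    using side_edge[OF assms assms] by auto
qed

text \<open>Letters 1 and 2 cut the old edge at its new centre and send \<open>(1, 0)\<close> to its
  two ends, so letter 1 reverses the orientation and letter 2 keeps it. Letter 3 attaches a new leaf
  to the centre, and all old vertices are on the side of the centre.\<close>

lemma side_snoc:
  "p \<in> vertices c n \<Longrightarrow> j \<in> words letters n \<Longrightarrow>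
    side (j @ [1]) p = 1 - side j p \<and> side (j @ [2]) p = side j p \<and> side (j @ [3]) p = 0"
proof (induction n arbitrary: p j)
  case 0
  have "side (k # []) (0, 0) = side [] (if k = 1 then (1, 0) else (0, 0))"
    "side (k # []) (1, 0) = side [] (if k = 2 then (1, 0) else (0, 0))" if "k \<in> letters" for k
    using side_psi_if[of "(1, 0)" 1 k "[]"] side_psi_if[of "(1, 0)" 2 k "[]"] that
    unfolding psi_ends by auto
  then show ?case using 0 by (auto simp: vertices_0)
next
  case (Suc n)
  obtain k q where q: "p = psi c k q" "k \<in> letters" "q \<in> vertices c n"
    using Suc.prems(1) unfolding vertices_Suc by blast
  obtain l j' where j: "j = l # j'" "l \<in> letters" "j' \<in> words letters n"
    using Suc.prems(2) unfolding words_Suc by auto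
  show ?case
    unfolding j q append_Cons side_psi_if[OF vertices_rhombus[OF q(3)] q(2) j(2)]
    using Suc.IH[of q j'] Suc.IH[of "(0, 0)" j'] j(3) q(3) by auto
qed

text \<open>The edges with \<open>side j x \<noteq> side j y\<close> form the path between the two
  vertices, and the sign of the coefficient is the direction of travel. So the sum telescopes along
  that path.\<close>

lemma telescoping:
  assumes "x \<in> vertices c n" "y \<in> vertices c n"
  shows "f x - f y = (\<Sum>j\<in>words letters n.
    (side j x - side j y) * (f (psi_word c j (1, 0)) - f (psi_word c j (0, 0))))"
  (is "_ = ?S f n x y")
proof -
  have *: "f x - f (0, 0) = (\<Sum>j\<in>words letters n. (side j x - side j (0, 0)) *
      (f (psi_word c j (1, 0)) - f (psi_word c j (0, 0))))" if "x \<in> vertices c n" for f :: "real \<times> real \<Rightarrow> real" and x n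
    using that
  proof (induction n arbitrary: x f)
    case 0 then show ?case by (auto simp: vertices_0)
  next
    case (Suc n)
    \<comment> \<open>The reference point moves to the centre, the image of \<open>(0, 0)\<close> in
      each branch. Branches without \<open>x\<close> then contribute 0, and the remaining one is the
      induction hypothesis for \<open>f\<close> composed with its map.\<close>
    have centre: "f x - f (1 / 2, 0) = (\<Sum>j\<in>words letters (Suc n). (side j x - side j (1 / 2, 0)) *
      (f (psi_word c j (1, 0)) - f (psi_word c j (0, 0))))" if x: "x \<in> vertices c (Suc n)" for x
    proof -
      obtain k q where q: "x = psi c k q" "k \<in> letters" "q \<in> vertices c n"
        using x unfolding vertices_Suc by blast
      have z: "(1 / 2, 0) = psi c k (0, 0)" by (simp add: psi_centre)
      define g where "g p = f (psi c k p)" for p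
      have "(\<Sum>j\<in>words letters (Suc n). (side j x - side j (1 / 2, 0)) *
          (f (psi_word c j (1, 0)) - f (psi_word c j (0, 0)))) =
        (\<Sum>l\<in>letters. \<Sum>j\<in>words letters n.
          (side j (if l = k then q else (0, 0)) - side j (0, 0)) *
          (f (psi c l (psi_word c j (1, 0))) - f (psi c l (psi_word c j (0, 0)))))"
        unfolding sum_words_Suc q(1) z
        by (intro sum.cong refl)
          (simp add: side_psi_if[OF vertices_rhombus[OF q(3)] q(2)] side_psi_if[OF _ q(2)])
      also have "\<dots> = (\<Sum>l\<in>letters. if l = k then g q - g (0, 0) else 0)"
        by (intro sum.cong refl) (use Suc.IH[OF q(3), of g] in \<open>simp add: g_def\<close>)
      also have "\<dots> = g q - g (0, 0)" using q(2) by auto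
      finally show ?thesis by (simp add: g_def q(1) z[symmetric] psi_centre)
    qed
    have "f x - f (0, 0) = (f x - f (1 / 2, 0)) - (f (0, 0) - f (1 / 2, 0))" by simp
    also have "\<dots> = (\<Sum>j\<in>words letters (Suc n). (side j x - side j (0, 0)) *
      (f (psi_word c j (1, 0)) - f (psi_word c j (0, 0))))"
      unfolding centre[OF Suc.prems] centre[OF ends_in_vertices(1)] sum_subtractf[symmetric]
      by (intro sum.cong refl) (simp add: algebra_simps)
    finally show ?case .
  qed
  have "f x - f y = (f x - f (0, 0)) - (f y - f (0, 0))" by simp
  also have "\<dots> = ?S f n x y"
    unfolding *[OF assms(1), of f] *[OF assms(2), of f] sum_subtractf[symmetric]
    by (intro sum.cong refl) (simp add: algebra_simps)
  finally show ?thesis .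
qed

text \<open>Path length written through cuts: for vertices of level \<open>n\<close>, exactly the
  edges that separate them contribute.\<close>

definition tdist :: "(nat list \<Rightarrow> real) \<Rightarrow> nat \<Rightarrow> real \<times> real \<Rightarrow> real \<times> real \<Rightarrow> real" where
  "tdist \<rho> n x y = (\<Sum>j\<in>words letters n. \<rho> j * \<bar>side j x - side j y\<bar>)"

definition consistent :: "(nat list \<Rightarrow> real) \<Rightarrow> bool" where
  "consistent \<rho> \<longleftrightarrow> (\<forall>i\<in>lists letters. 0 < \<rho> i \<and> \<rho> i = \<rho> (i @ [1]) + \<rho> (i @ [2]))"

lemma consistent_Cons: "consistent \<rho> \<Longrightarrow> k \<in> letters \<Longrightarrow> consistent (\<lambda>i. \<rho> (k # i))"
  unfolding consistent_def by (metis Cons_in_lists_iff append_Cons)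

lemma words_lists: "i \<in> words A n \<Longrightarrow> i \<in> lists A"
  by (simp add: words_def)

lemma consistent_pos: "consistent \<rho> \<Longrightarrow> i \<in> words letters n \<Longrightarrow> 0 < \<rho> i"
  unfolding consistent_def using words_lists by blast

lemma tdist_nonneg: "consistent \<rho> \<Longrightarrow> 0 \<le> tdist \<rho> n x y"
  unfolding tdist_def
  by (intro sum_nonneg mult_nonneg_nonneg) (auto dest: consistent_pos intro: less_imp_le)

lemma tdist_commute: "tdist \<rho> n x y = tdist \<rho> n y x"
  unfolding tdist_def by (simp add: abs_minus_commute)

lemma tdist_refl [simp]: "tdist \<rho> n x x = 0"
  unfolding tdist_def by simp

lemma tdist_triangle: "consistent \<rho> \<Longrightarrow> tdist \<rho> n x z \<le> tdist \<rho> n x y + tdist \<rho> n y z"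
  unfolding tdist_def sum.distrib[symmetric] distrib_left[symmetric]
  by (intro sum_mono mult_left_mono) (auto dest: consistent_pos intro: less_imp_le)

lemma tdist_Suc:
  assumes \<rho>: "consistent \<rho>" and xy: "x \<in> vertices c n" "y \<in> vertices c n"
  shows "tdist \<rho> (Suc n) x y = tdist \<rho> n x y"
  unfolding tdist_def sum_words_Suc_snoc
proof (intro sum.cong refl)
  fix j assume j: "j \<in> words letters n"
  have "\<rho> j = \<rho> (j @ [1]) + \<rho> (j @ [2])"
    using \<rho> words_lists[OF j] unfolding consistent_def by blast
  moreover have "\<bar>side (j @ [1]) x - side (j @ [1]) y\<bar> = \<bar>side j x - side j y\<bar>"
    "\<bar>side (j @ [2]) x - side (j @ [2]) y\<bar> = \<bar>side j x - side j y\<bar>"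
    "\<bar>side (j @ [3]) x - side (j @ [3]) y\<bar> = 0"
    using side_snoc[OF xy(1) j] side_snoc[OF xy(2) j] by auto
  ultimately show "(\<Sum>k\<in>letters. \<rho> (j @ [k]) * \<bar>side (j @ [k]) x - side (j @ [k]) y\<bar>) =
      \<rho> j * \<bar>side j x - side j y\<bar>"
    by (simp add: distrib_right)
qed

lemma tdist_level:
  assumes "consistent \<rho>" "x \<in> vertices c m" "y \<in> vertices c m" "m \<le> n"
  shows "tdist \<rho> n x y = tdist \<rho> m x y"
  using assms(4)
proof (induction n rule: dec_induct)
  case (step n)
  then show ?case using tdist_Suc[OF assms(1), of x n y] vertices_mono assms(2,3)
    by (metis less_imp_le subsetD)
qed simp

lemma tdist_psi:
  assumes "x \<in> vertices c n" "y \<in> vertices c n" "k \<in> letters"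
  shows "tdist \<rho> (Suc n) (psi c k x) (psi c k y) = tdist (\<lambda>i. \<rho> (k # i)) n x y"
proof -
  have "tdist \<rho> (Suc n) (psi c k x) (psi c k y) =
      (\<Sum>l\<in>letters. if l = k then tdist (\<lambda>i. \<rho> (k # i)) n x y else 0)"
    unfolding tdist_def sum_words_Suc
    by (intro sum.cong refl)
      (simp add: side_psi_if[OF vertices_rhombus[OF assms(1)] assms(3)]
        side_psi_if[OF vertices_rhombus[OF assms(2)] assms(3)])
  then show ?thesis using assms(3) by auto
qed

text \<open>A path between different branches runs through the centre, which is
  \<open>(0, 0)\<close> in the coordinates of either branch.\<close>

lemma tdist_psi_other:
  assumes "x \<in> vertices c n" "y \<in> vertices c n" "k \<in> letters" "l \<in> letters" "k \<noteq> l"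
  shows "tdist \<rho> (Suc n) (psi c k x) (psi c l y) =
    tdist (\<lambda>i. \<rho> (k # i)) n x (0, 0) + tdist (\<lambda>i. \<rho> (l # i)) n (0, 0) y"
proof -
  have "tdist \<rho> (Suc n) (psi c k x) (psi c l y) =
      (\<Sum>m\<in>letters. (if m = k then tdist (\<lambda>i. \<rho> (k # i)) n x (0, 0) else 0) +
         (if m = l then tdist (\<lambda>i. \<rho> (l # i)) n (0, 0) y else 0))"
    unfolding tdist_def sum_words_Suc
    by (intro sum.cong refl)
      (use assms(5) in \<open>auto simp: side_psi_if[OF vertices_rhombus[OF assms(1)] assms(3)]
        side_psi_if[OF vertices_rhombus[OF assms(2)] assms(4)]\<close>)
  then show ?thesis using assms(3-5) by (auto simp: sum.distrib)
qed

text \<open>By \<open>side_edge\<close> only the term of \<open>i\<close> changes along the edge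
  \<open>i\<close>, and its sign tells on which side \<open>x\<close> lies. This makes the energy of
  the potential computable edge by edge.\<close>

lemma tdist_edge_diff:
  assumes "i \<in> words letters n" "x \<in> vertices c n"
  shows "tdist \<rho> n (psi_word c i (1, 0)) x - tdist \<rho> n (psi_word c i (0, 0)) x =
    \<rho> i * (1 - 2 * side i x)"
proof -
  have "tdist \<rho> n (psi_word c i (1, 0)) x - tdist \<rho> n (psi_word c i (0, 0)) x =
    (\<Sum>j\<in>words letters n. if j = i then \<rho> i * (1 - 2 * side i x) else 0)"
    unfolding tdist_def sum_subtractf[symmetric]
  proof (intro sum.cong refl)
    fix j assume j: "j \<in> words letters n"
    show "\<rho> j * \<bar>side j (psi_word c i (1, 0)) - side j x\<bar> -
        \<rho> j * \<bar>side j (psi_word c i (0, 0)) - side j x\<bar> =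
      (if j = i then \<rho> i * (1 - 2 * side i x) else 0)"
      using side_edge[OF assms(1) j] side_edge_ends[OF assms(1)] side_01[OF assms(2) assms(1)]
      by (auto simp: algebra_simps)
  qed
  then show ?thesis using assms(1) by auto
qed

lemma edge_vertices:
  assumes "i \<in> words letters n"
  shows "psi_word c i (0, 0) \<in> vertices c n" "psi_word c i (1, 0) \<in> vertices c n"
  using assms by (auto simp: vertices_def)

lemma tdist_edge:
  assumes "i \<in> words letters n"
  shows "tdist \<rho> n (psi_word c i (0, 0)) (psi_word c i (1, 0)) = \<rho> i"
  using tdist_edge_diff[OF assms edge_vertices(2)[OF assms], of \<rho>] side_edge_ends[OF assms]
  by simp

text \<open>Cauchy-Schwarz for \<open>telescoping\<close>, with \<open>\<rho>\<close> divided
  between the factors as square roots. The first factor is the path length because a difference of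
  sides squares to its absolute value. For \<open>f x = 0\<close> and \<open>f y = 1\<close> the
  energy is bounded below by the reciprocal distance.\<close>

lemma telescoping_bound:
  assumes \<rho>: "consistent \<rho>" and xy: "x \<in> vertices c n" "y \<in> vertices c n"
  shows "(f x - f y)^2 \<le> tdist \<rho> n x y *
    (\<Sum>i\<in>words letters n. 1 / \<rho> i * (f (psi_word c i (0, 0)) - f (psi_word c i (1, 0)))^2)"
proof -
  let ?D = "\<lambda>j. f (psi_word c j (1, 0)) - f (psi_word c j (0, 0))"
  have pos: "0 < \<rho> j" if "j \<in> words letters n" for j using consistent_pos[OF \<rho> that] .
  have "f x - f y = (\<Sum>j\<in>words letters n. (sqrt (\<rho> j) * (side j x - side j y)) * (?D j / sqrt (\<rho> j)))"
    unfolding telescoping[OF xy, of f] by (intro sum.cong refl) (simp add: less_imp_neq[OF pos, symmetric])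
  then have "(f x - f y)^2 \<le> (\<Sum>j\<in>words letters n. (sqrt (\<rho> j) * (side j x - side j y))^2) *
      (\<Sum>j\<in>words letters n. (?D j / sqrt (\<rho> j))^2)"
    by (simp only: Cauchy_Schwarz_ineq_sum)
  also have "(\<Sum>j\<in>words letters n. (sqrt (\<rho> j) * (side j x - side j y))^2) = tdist \<rho> n x y"
    unfolding tdist_def
  proof (intro sum.cong refl)
    fix j assume j: "j \<in> words letters n"
    show "(sqrt (\<rho> j) * (side j x - side j y))^2 = \<rho> j * \<bar>side j x - side j y\<bar>"
      using side_01[OF xy(1) j] side_01[OF xy(2) j] pos[OF j] by (auto simp: power_mult_distrib)
  qed
  also have "(\<Sum>j\<in>words letters n. (?D j / sqrt (\<rho> j))^2) =
      (\<Sum>i\<in>words letters n. 1 / \<rho> i * (f (psi_word c i (0, 0)) - f (psi_word c i (1, 0)))^2)"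
    by (intro sum.cong refl) (use pos in \<open>auto simp: power_divide power2_commute less_imp_le\<close>)
  finally show ?thesis .
qed

lemma tdist_pos:
  assumes "consistent \<rho>" "x \<in> vertices c n" "y \<in> vertices c n" "x \<noteq> y"
  shows "0 < tdist \<rho> n x y"
  \<comment> \<open>Tested with the indicator of \<open>x\<close>, the left-hand side is 1, so the
    factor \<open>tdist\<close> cannot vanish.\<close>
  using telescoping_bound[OF assms(1-3), of "\<lambda>p. of_bool (p = x)"] assms(4) tdist_nonneg[OF assms(1), of n x y]
  by (cases "tdist \<rho> n x y = 0") auto

section \<open>Energy minimisation and the resistance\<close>

lemma weighted_square_le:
  fixes p q :: real
  assumes "0 < p" "0 < q"
  shows "1 / (p + q) * (a + b)^2 \<le> 1 / p * a^2 + 1 / q * b^2"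
proof -
  \<comment> \<open>Two resistors in series dissipate least when the drops \<open>a\<close> and
    \<open>b\<close> are proportional to \<open>p\<close> and \<open>q\<close>; the defect measures
    the deviation from that.\<close>
  have "(1 / p * a^2 + 1 / q * b^2) * (p + q) - (a + b)^2 = (q * a - p * b)^2 / (p * q)"
    using assms by (simp add: field_simps power2_eq_square)
  also have "\<dots> \<ge> 0" using assms by auto
  finally show ?thesis using assms by (simp add: field_simps)
qed

text \<open>The next level inserts a centre into each edge. Children 1 and 2 are in series with the
  total resistance of the parent, so any value at the centre costs at least the old energy, and
  child 3 only adds to it. Hence the energy at any level is a lower bound for the limit.\<close>

lemma energy_Suc_mono:
  assumes "consistent (\<lambda>i. edge_length v i * cascade_limit v i)"
  shows "energy c v n f \<le> energy c v (Suc n) f"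
  unfolding energy_def sum_words_Suc_snoc
proof (rule sum_mono)
  fix i assume i: "i \<in> words letters n"
  define \<rho> where "\<rho> i = edge_length v i * cascade_limit v i" for i
  have i': "i @ [k] \<in> words letters (Suc n)" if "k \<in> letters" for k
    using i that by (auto simp: words_def)
  have "\<rho> i = \<rho> (i @ [1]) + \<rho> (i @ [2])"
    using assms words_lists[OF i] unfolding consistent_def \<rho>_def by blast
  moreover have "0 < \<rho> (i @ [k])" if "k \<in> letters" for k
    using consistent_pos[OF assms i'[OF that]] unfolding \<rho>_def .
  ultimately have \<rho>: "\<rho> i = \<rho> (i @ [1]) + \<rho> (i @ [2])" "0 < \<rho> (i @ [1])" "0 < \<rho> (i @ [2])" "0 < \<rho> (i @ [3])"
    by simp_all
  let ?f = "\<lambda>i p. f (psi_word c i p)"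
  have e: "?f i (0, 0) = ?f (i @ [1]) (1, 0)" "?f i (1, 0) = ?f (i @ [2]) (1, 0)"
    "?f (i @ [1]) (0, 0) = ?f (i @ [2]) (0, 0)"
    unfolding psi_word_append psi_word_Cons psi_word_Nil psi_centre psi_ends by simp_all
  have "1 / \<rho> i * (?f i (0, 0) - ?f i (1, 0))^2 =
     1 / (\<rho> (i @ [1]) + \<rho> (i @ [2])) * ((?f (i @ [1]) (1, 0) - ?f (i @ [1]) (0, 0)) +
        (?f (i @ [2]) (0, 0) - ?f (i @ [2]) (1, 0)))^2"
    unfolding \<rho>(1) e by simp
  also have "\<dots> \<le> 1 / \<rho> (i @ [1]) * (?f (i @ [1]) (0, 0) - ?f (i @ [1]) (1, 0))^2
      + 1 / \<rho> (i @ [2]) * (?f (i @ [2]) (0, 0) - ?f (i @ [2]) (1, 0))^2"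
    using weighted_square_le[OF \<rho>(2,3)] unfolding power2_commute[of "?f (i @ [1]) (0, 0)"] .
  also have "\<dots> \<le> \<dots> + 1 / \<rho> (i @ [3]) * (?f (i @ [3]) (0, 0) - ?f (i @ [3]) (1, 0))^2"
    using \<rho> by simp
  finally show "1 / (edge_length v i * cascade_limit v i) * (?f i (0, 0) - ?f i (1, 0))^2 \<le>
     (\<Sum>k\<in>letters. 1 / (edge_length v (i @ [k]) * cascade_limit v (i @ [k])) *
        (?f (i @ [k]) (0, 0) - ?f (i @ [k]) (1, 0))^2)"
    by (simp add: \<rho>_def add.assoc)
qed

text \<open>On a tree with path distance d the potential is (d(p, x) - d(p, y) + d(x, y)) / (2 d(x, y)).\<close>

lemma potential_exists:
  assumes \<rho>: "consistent (\<lambda>i. edge_length v i * cascade_limit v i)" (is "consistent ?l")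
    and xy: "x \<in> vertices c n" "y \<in> vertices c n" "x \<noteq> y"
  obtains f where "f x = 0" "f y = 1" "\<And>m. n \<le> m \<Longrightarrow> energy c v m f = 1 / tdist ?l n x y"
proof -
  \<comment> \<open>One function has to serve all levels, while \<open>tdist\<close> is meaningful
    at \<open>p\<close> only from the level of \<open>p\<close> on. Hence the least admissible
    level; later levels give the same value by \<open>tdist_level\<close>.\<close>
  define L where "L p = (LEAST m. n \<le> m \<and> p \<in> vertices c m)" for p
  let ?d = "tdist ?l n x y"
  define f where "f p = (tdist ?l (L p) p x - tdist ?l (L p) p y + ?d) / (2 * ?d)" for p
  have d: "?d > 0" using tdist_pos[OF \<rho> xy] .
  have f: "f p = (tdist ?l m p x - tdist ?l m p y + ?d) / (2 * ?d)"
    if m: "n \<le> m" "p \<in> vertices c m" for m p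
  proof -
    have L: "n \<le> L p \<and> p \<in> vertices c (L p)" "L p \<le> m"
      unfolding L_def using m LeastI[of "\<lambda>m. n \<le> m \<and> p \<in> vertices c m" m]
      by (simp_all add: Least_le)
    then have "x \<in> vertices c (L p)" "y \<in> vertices c (L p)" using vertices_mono xy by blast+
    then show ?thesis
      unfolding f_def
      using L tdist_level[OF \<rho>, of p "L p" x m] tdist_level[OF \<rho>, of p "L p" y m] by simp
  qed
  show ?thesis
  proof
    show "f x = 0" using f[of n x] xy by simp
    show "f y = 1" using f[of n y] xy d by (simp add: tdist_commute[of _ _ y x])
    fix m assume m: "n \<le> m"
    have xy': "x \<in> vertices c m" "y \<in> vertices c m" using vertices_mono[OF m] xy by auto
    have "energy c v m f = (\<Sum>i\<in>words letters m. ?l i * \<bar>side i x - side i y\<bar> / ?d^2)"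
      unfolding energy_def
    proof (intro sum.cong refl)
      fix i assume i: "i \<in> words letters m"
      note e = edge_vertices[OF i]
      have "f (psi_word c i (1, 0)) - f (psi_word c i (0, 0)) =
        ((tdist ?l m (psi_word c i (1, 0)) x - tdist ?l m (psi_word c i (0, 0)) x) -
         (tdist ?l m (psi_word c i (1, 0)) y - tdist ?l m (psi_word c i (0, 0)) y)) / (2 * ?d)"
        unfolding f[OF m e(1)] f[OF m e(2)] by (simp add: diff_divide_distrib add_divide_distrib)
      also have "\<dots> = ?l i * (side i y - side i x) / ?d"
        unfolding tdist_edge_diff[OF i xy'(1)] tdist_edge_diff[OF i xy'(2)]
        using d by (simp add: field_simps)
      finally have "(f (psi_word c i (0, 0)) - f (psi_word c i (1, 0)))^2 = (?l i)^2 * (side i x - side i y)^2 / ?d^2"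
        by (metis power2_commute power_divide power_mult_distrib)
      moreover have "(side i x - side i y)^2 = \<bar>side i x - side i y\<bar>"
        using side_01[OF xy'(1) i] side_01[OF xy'(2) i] by auto
      moreover have "?l i > 0" using consistent_pos[OF \<rho> i] .
      ultimately show "1 / ?l i * (f (psi_word c i (0, 0)) - f (psi_word c i (1, 0)))^2 =
          ?l i * \<bar>side i x - side i y\<bar> / ?d^2"
        by (simp add: power2_eq_square)
    qed
    also have "\<dots> = tdist ?l m x y / ?d^2" unfolding tdist_def sum_divide_distrib ..
    also have "\<dots> = 1 / ?d"
      using tdist_level[OF \<rho> xy(1,2) m] d by (simp add: power2_eq_square)
    finally show "energy c v m f = 1 / ?d" .
  qed
qed

text \<open>The infimum is attained: the potential has the reciprocal distance as energy from level
  \<open>n\<close> on, every competitor has at least this energy at level \<open>n\<close> by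
  \<open>telescoping_bound\<close>, and energies increase with the level.\<close>

lemma resistance_eq_tdist:
  assumes \<rho>: "consistent (\<lambda>i. edge_length v i * cascade_limit v i)" (is "consistent ?l")
    and xy: "x \<in> vertices c n" "y \<in> vertices c n"
  shows "resistance c v x y = tdist ?l n x y"
proof (cases "x = y")
  case False
  let ?d = "tdist ?l n x y"
  have d: "?d > 0" using tdist_pos[OF \<rho> xy False] .
  obtain f where f: "f x = 0" "f y = 1" "\<And>m. n \<le> m \<Longrightarrow> energy c v m f = 1 / ?d"
    using potential_exists[OF \<rho> xy False] by blast
  have lim: "(\<lambda>m. energy c v m f) \<longlonglongrightarrow> 1 / ?d"
    by (intro tendsto_eventually) (use f(3) in \<open>auto simp: eventually_sequentially\<close>)
  let ?F = "{f \<in> energy_domain c v. f x = 0 \<and> f y = 1}"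
  have "(INF f\<in>?F. energy_limit c v f) = 1 / ?d"
  proof (rule cInf_eq_minimum)
    show "1 / ?d \<in> energy_limit c v ` ?F"
      using lim f by (auto simp: energy_domain_def energy_limit_def convergent_def
          intro!: image_eqI[of _ _ f] limI[symmetric])
  next
    fix e assume "e \<in> energy_limit c v ` ?F"
    then obtain g where g: "g \<in> energy_domain c v" "g x = 0" "g y = 1" "e = energy_limit c v g"
      by blast
    have "(\<lambda>m. energy c v m g) \<longlonglongrightarrow> e"
      using g by (simp add: energy_domain_def energy_limit_def convergent_LIMSEQ_iff)
    then have "energy c v n g \<le> e"
      by (rule incseq_le[rotated]) (intro incseq_SucI energy_Suc_mono[OF \<rho>])
    then have "?d * energy c v n g \<le> ?d * e" using d by (intro mult_left_mono) auto
    with telescoping_bound[OF \<rho> xy, of g] have "1 \<le> e * ?d"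
      unfolding g energy_def by (simp add: mult.commute)
    then show "1 / ?d \<le> e" using d by (simp only: pos_divide_le_eq)
  qed
  then show ?thesis using False by (simp add: resistance_def)
qed (simp add: resistance_def)

section \<open>Lower bounds for distances between disjoint cells\<close>

lemma tdist_end_ge:
  assumes "consistent \<rho>" "e = (0, 0) \<or> e = (1, 0)" "i \<in> lists letters" "e \<notin> psi_word c i ` rhombus"
  shows "\<exists>\<delta>>0. \<forall>m. \<forall>x\<in>psi_word c i ` vertices c m. \<delta> \<le> tdist \<rho> (length i + m) e x"
  using assms
proof (induction i arbitrary: \<rho> e rule: list.induct)
  case (Cons k i)
  \<comment> \<open>The branch that contains the end \<open>e\<close>; there \<open>e\<close> is the
    image of \<open>(1, 0)\<close>, the end with which the induction continues.\<close>
  define l :: nat where "l = (if e = (0, 0) then 1 else 2)"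
  have l: "l \<in> letters" "e = psi c l (1, 0)" using Cons.prems psi_ends by (auto simp: l_def)
  have k: "k \<in> letters" "i \<in> lists letters" using Cons.prems by auto
  note \<rho>_l = consistent_Cons[OF Cons.prems(1) l(1)] and \<rho>_k = consistent_Cons[OF Cons.prems(1) k(1)]
  have split: "\<exists>y\<in>vertices c (length i + m). x = psi c k y \<and> y \<in> psi_word c i ` vertices c m"
    if "x \<in> psi_word c (k # i) ` vertices c m" for x m
    using that k psi_word_vertices[of i _ m] unfolding psi_word_Cons_image by blast
  show ?case
  proof (cases "k = l")
    case True
    then have "(1, 0) \<notin> psi_word c i ` rhombus"
      using Cons.prems(4) unfolding l psi_word_Cons_image by blast
    then obtain \<delta> where \<delta>: "\<delta> > 0"
      "\<forall>m. \<forall>x\<in>psi_word c i ` vertices c m. \<delta> \<le> tdist (\<lambda>i. \<rho> (l # i)) (length i + m) (1, 0) x"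
      using Cons.IH[OF \<rho>_l, of "(1, 0)"] k by blast
    have "\<delta> \<le> tdist \<rho> (length (k # i) + m) e x" if x: "x \<in> psi_word c (k # i) ` vertices c m" for m x
    proof -
      obtain y where y: "y \<in> vertices c (length i + m)" "x = psi c k y" "y \<in> psi_word c i ` vertices c m"
        using split[OF x] by blast
      show ?thesis
        unfolding y(2) l(2) using tdist_psi[OF ends_in_vertices(2) y(1) l(1), of \<rho>] \<delta>(2)[rule_format, OF y(3)] True by simp
    qed
    then show ?thesis using \<delta>(1) by blast
  next
    case False
    \<comment> \<open>Once the branches differ, the path from \<open>e\<close> has to run along the
      whole edge \<open>[l]\<close> to reach the centre; consistency makes its length the same at
      all levels.\<close>
    have "\<rho> [l] \<le> tdist \<rho> (length (k # i) + m) e x" if x: "x \<in> psi_word c (k # i) ` vertices c m" for m x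
    proof -
      obtain y where y: "y \<in> vertices c (length i + m)" "x = psi c k y"
        using split[OF x] by blast
      have "tdist \<rho> (length (k # i) + m) e x = tdist (\<lambda>i. \<rho> (l # i)) (length i + m) (1, 0) (0, 0)
         + tdist (\<lambda>i. \<rho> (k # i)) (length i + m) (0, 0) y"
        using tdist_psi_other[OF ends_in_vertices(2) y(1) l(1) k(1), of \<rho>] False by (simp add: y l(2))
      moreover have "tdist (\<lambda>i. \<rho> (l # i)) (length i + m) (1, 0) (0, 0) = \<rho> [l]"
        using tdist_level[OF \<rho>_l, of "(1, 0)" 0 "(0, 0)" "length i + m"] by (simp add: tdist_def)
      ultimately show ?thesis using tdist_nonneg[OF \<rho>_k] by simp
    qed
    moreover have "\<rho> [l] > 0" using consistent_pos[OF \<rho>_l, of "[]" 0] by simp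
    ultimately show ?thesis by blast
  qed
qed auto

text \<open>A common first letter is removed by self-similarity. For different letters the path runs
  through the centre, and disjointness means that one of the cells misses it, so
  \<open>tdist_end_ge\<close> bounds that leg. The bound serves all \<open>m\<close> at once, which
  lets it survive the passage to the limit.\<close>

lemma tdist_cells_ge:
  assumes "consistent \<rho>" "i \<in> lists letters" "j \<in> lists letters" "length i = length j"
    "psi_word c i ` rhombus \<inter> psi_word c j ` rhombus = {}"
  shows "\<exists>\<delta>>0. \<forall>m. \<forall>x\<in>psi_word c i ` vertices c m. \<forall>y\<in>psi_word c j ` vertices c m.
    \<delta> \<le> tdist \<rho> (length i + m) x y"
  using assms
proof (induction i arbitrary: \<rho> j rule: list.induct)
  case (Cons k i)
  obtain l j' where j: "j = l # j'" using Cons.prems by (cases j) auto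
  have k: "k \<in> letters" "i \<in> lists letters" "l \<in> letters" "j' \<in> lists letters" "length i = length j'"
    using Cons.prems by (auto simp: j)
  note \<rho>_l = consistent_Cons[OF Cons.prems(1) k(3)] and \<rho>_k = consistent_Cons[OF Cons.prems(1) k(1)]
  have split: "\<exists>p\<in>vertices c (length i + m). \<exists>q\<in>vertices c (length i + m).
      x = psi c k p \<and> p \<in> psi_word c i ` vertices c m \<and> y = psi c l q \<and> q \<in> psi_word c j' ` vertices c m"
    if "x \<in> psi_word c (k # i) ` vertices c m" "y \<in> psi_word c j ` vertices c m" for x y m
    using that k psi_word_vertices[of i _ m] psi_word_vertices[of j' _ m]
    unfolding j psi_word_Cons_image k(5) by blast
  show ?case
  proof (cases "k = l")
    case True
    have "psi_word c i ` rhombus \<inter> psi_word c j' ` rhombus = {}"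
      using Cons.prems(5) unfolding j True psi_word_Cons_image by blast
    then obtain \<delta> where \<delta>: "\<delta> > 0" "\<forall>m. \<forall>x\<in>psi_word c i ` vertices c m. \<forall>y\<in>psi_word c j' ` vertices c m.
        \<delta> \<le> tdist (\<lambda>i. \<rho> (k # i)) (length i + m) x y"
      using Cons.IH[OF \<rho>_k k(2,4,5)] by blast
    have "\<delta> \<le> tdist \<rho> (length (k # i) + m) x y"
      if xy: "x \<in> psi_word c (k # i) ` vertices c m" "y \<in> psi_word c j ` vertices c m" for m x y
    proof -
      obtain p q where pq: "p \<in> vertices c (length i + m)" "q \<in> vertices c (length i + m)"
        "x = psi c k p" "p \<in> psi_word c i ` vertices c m" "y = psi c k q" "q \<in> psi_word c j' ` vertices c m"
        using split[OF xy] True by blast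
      show ?thesis
        unfolding pq(3,5) using tdist_psi[OF pq(1,2) k(1), of \<rho>] \<delta>(2)[rule_format, OF pq(4,6)] by simp
    qed
    then show ?thesis using \<delta>(1) by blast
  next
    case False
    have "(1 / 2, 0) \<notin> psi_word c (k # i) ` rhombus \<or> (1 / 2, 0) \<notin> psi_word c j ` rhombus"
      using Cons.prems(5) by blast
    then have "(0, 0) \<notin> psi_word c i ` rhombus \<or> (0, 0) \<notin> psi_word c j' ` rhombus"
      unfolding j psi_word_Cons_image using psi_centre by (metis image_eqI)
    then obtain \<delta> where \<delta>: "\<delta> > 0" "(\<forall>m. \<forall>x\<in>psi_word c i ` vertices c m.
          \<delta> \<le> tdist (\<lambda>i. \<rho> (k # i)) (length i + m) (0, 0) x) \<or>
        (\<forall>m. \<forall>x\<in>psi_word c j' ` vertices c m. \<delta> \<le> tdist (\<lambda>i. \<rho> (l # i)) (length i + m) (0, 0) x)"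
      using tdist_end_ge[OF \<rho>_k, of "(0, 0)" i] tdist_end_ge[OF \<rho>_l, of "(0, 0)" j'] k by metis
    have "\<delta> \<le> tdist \<rho> (length (k # i) + m) x y"
      if xy: "x \<in> psi_word c (k # i) ` vertices c m" "y \<in> psi_word c j ` vertices c m" for m x y
    proof -
      obtain p q where pq: "p \<in> vertices c (length i + m)" "q \<in> vertices c (length i + m)"
        "x = psi c k p" "p \<in> psi_word c i ` vertices c m" "y = psi c l q" "q \<in> psi_word c j' ` vertices c m"
        using split[OF xy] by blast
      have "tdist \<rho> (length (k # i) + m) x y = tdist (\<lambda>i. \<rho> (k # i)) (length i + m) (0, 0) p
         + tdist (\<lambda>i. \<rho> (l # i)) (length i + m) (0, 0) q"
        using tdist_psi_other[OF pq(1,2) k(1,3) False, of \<rho>] by (simp add: pq tdist_commute[of _ _ p])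
      moreover have "\<delta> \<le> tdist (\<lambda>i. \<rho> (k # i)) (length i + m) (0, 0) p \<or>
          \<delta> \<le> tdist (\<lambda>i. \<rho> (l # i)) (length i + m) (0, 0) q"
        using \<delta>(2) pq by blast
      ultimately show ?thesis
        using tdist_nonneg[OF \<rho>_k, of "length i + m" "(0, 0)" p] tdist_nonneg[OF \<rho>_l, of "length i + m" "(0, 0)" q]
        by linarith
    qed
    then show ?thesis using \<delta>(1) by blast
  qed
next
  case Nil
  then show ?case using ends_in_rhombus(1) by (auto simp del: ends_in_rhombus)
qed

section \<open>Upper bounds for distances inside a cell\<close>

lemma tdist_descend:
  assumes \<rho>: "consistent \<rho>" and s: "\<And>i. i \<in> lists letters \<Longrightarrow> \<rho> i \<le> s (length i)"
    and i: "i \<in> words letters n"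
  shows "j \<in> words letters m \<Longrightarrow>
    tdist \<rho> (n + m) (psi_word c i (0, 0)) (psi_word c (i @ j) (0, 0)) \<le> (\<Sum>k<m. s (n + k))"
proof (induction m arbitrary: j)
  case (Suc m)
  obtain j' a where j: "j = j' @ [a]" "j' \<in> words letters m" "a \<in> letters"
    using Suc.prems unfolding words_Suc_snoc by auto
  let ?w = "i @ j'"
  have w: "?w \<in> words letters (n + m)" "i @ j \<in> words letters (n + Suc m)"
      "?w @ [1] \<in> words letters (n + Suc m)" "?w @ [2] \<in> words letters (n + Suc m)"
    using i j by (auto simp: words_def)
  have v: "psi_word c i (0, 0) \<in> vertices c (n + m)" "psi_word c ?w (0, 0) \<in> vertices c (n + m)"
    using edge_vertices(1)[OF i] edge_vertices(1)[OF w(1)] vertices_mono[of n "n + m"] by auto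
  \<comment> \<open>The centre of the cell \<open>?w\<close> is the \<open>(0, 0)\<close> end of all
    three children, so for each letter \<open>a\<close> the step runs along the edge
    \<open>?w @ [1]\<close>.\<close>
  have e: "psi_word c (i @ j) (0, 0) = psi_word c (?w @ [1]) (0, 0)"
    "psi_word c ?w (0, 0) = psi_word c (?w @ [1]) (1, 0)"
    unfolding j(1) append.assoc[symmetric] psi_word_append psi_word_Cons psi_word_Nil psi_centre psi_ends
    by simp_all
  have "tdist \<rho> (n + Suc m) (psi_word c ?w (0, 0)) (psi_word c (i @ j) (0, 0)) = \<rho> (?w @ [1])"
    unfolding e tdist_commute[of _ _ _ "psi_word c (?w @ [1]) (0, 0)"] by (rule tdist_edge[OF w(3)])
  also have "\<dots> \<le> \<rho> ?w"
    using \<rho> words_lists[OF w(1)] consistent_pos[OF \<rho> w(4)] unfolding consistent_def by (metis less_add_same_cancel1 less_imp_le)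
  also have "\<dots> \<le> s (n + m)" using s[OF words_lists[OF w(1)]] w(1) by (simp add: words_def)
  finally have "tdist \<rho> (n + Suc m) (psi_word c ?w (0, 0)) (psi_word c (i @ j) (0, 0)) \<le> s (n + m)" .
  moreover have "tdist \<rho> (n + Suc m) (psi_word c i (0, 0)) (psi_word c ?w (0, 0)) \<le> (\<Sum>k<m. s (n + k))"
    using Suc.IH[OF j(2)] tdist_level[OF \<rho> v, of "n + Suc m"] by simp
  ultimately show ?case
    using tdist_triangle[OF \<rho>, of "n + Suc m" "psi_word c i (0, 0)" "psi_word c (i @ j) (0, 0)" "psi_word c ?w (0, 0)"]
    by simp
qed simp

text \<open>The \<open>(0, 0)\<close> ends lead down to level \<open>n + m\<close> in
  \<open>m\<close> steps, and one last edge may be needed to reach the other end; hence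
  \<open>Suc m\<close> terms.\<close>

lemma tdist_cell_le:
  assumes \<rho>: "consistent \<rho>" and s: "\<And>i. i \<in> lists letters \<Longrightarrow> \<rho> i \<le> s (length i)"
    and i: "i \<in> words letters n" and x: "x \<in> psi_word c i ` vertices c m"
  shows "tdist \<rho> (n + m) (psi_word c i (0, 0)) x \<le> (\<Sum>k<Suc m. s (n + k))"
proof -
  obtain y where y: "y \<in> vertices c m" "x = psi_word c i y" using x by blast
  obtain j e where "j \<in> words letters m" "e \<in> {(0, 0), (1, 0)}" "y = psi_word c j e"
    using y(1) unfolding vertices_def by blast
  then have j: "j \<in> words letters m" "e = (0, 0) \<or> e = (1, 0)" "x = psi_word c (i @ j) e"
    using y(2) by (auto simp: psi_word_append)
  have w: "i @ j \<in> words letters (n + m)" using i j by (auto simp: words_def)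
  have l: "\<rho> (i @ j) \<le> s (n + m)" "0 < \<rho> (i @ j)"
    using s[OF words_lists[OF w]] consistent_pos[OF \<rho> w] w by (auto simp: words_def)
  have "tdist \<rho> (n + m) (psi_word c (i @ j) (0, 0)) x \<le> s (n + m)"
    using tdist_edge[OF w, of \<rho>] j(2) l unfolding j(3) by auto
  then show ?thesis
    using tdist_descend[OF \<rho> s i j(1)]
      tdist_triangle[OF \<rho>, of "n + m" "psi_word c i (0, 0)" x "psi_word c (i @ j) (0, 0)"] by simp
qed

end

section \<open>The limit metric\<close>

lemma finite_uniform_pos:
  assumes "finite A" "\<And>a. a \<in> A \<Longrightarrow> \<exists>e>0::real. P a e"
    and "\<And>a e e'. P a e \<Longrightarrow> 0 < e' \<Longrightarrow> e' \<le> e \<Longrightarrow> P a e'"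
  shows "\<exists>e>0. \<forall>a\<in>A. P a e"
  using assms(1,2)
proof (induction A)
  case (insert a A)
  obtain e where e: "e > 0" "\<forall>a\<in>A. P a e" using insert by blast
  obtain e' where e': "e' > 0" "P a e'" using insert by blast
  have "P b (min e e')" if "b \<in> insert a A" for b
    using that e e' assms(3)[of b e "min e e'"] assms(3)[of b e' "min e e'"] by auto
  then show ?case using e e' by (intro exI[of _ "min e e'"]) auto
qed (auto intro: exI[of _ 1])

context dendrite begin

text \<open>\<open>psi c 2\<close> fixes \<open>(1, 0)\<close> and \<open>psi c 1\<close> maps it to
  \<open>(0, 0)\<close>, so \<open>T\<close> contains V^0 and, by invariance, every vertex.
  Conversely, every point of \<open>T\<close> is an n-fold image of a point of \<open>T\<close> and
  therefore within \<open>B / 2 ^ n\<close> of a vertex.\<close>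

lemma attractor_eq_closure:
  assumes T: "compact T" "T \<noteq> {}" "T = (\<Union>i\<in>letters. psi c i ` T)"
  shows "T = closure (all_vertices c)"
proof
  have psi_T: "psi c k p \<in> T" if "k \<in> letters" "p \<in> T" for k p
    using that T(3) by blast
  have "(1, 0) \<in> T"
  proof -
    obtain t where t: "t \<in> T" using T(2) by blast
    define u where "u n = psi_word c (replicate n 2) t" for n
    have "u n \<in> T" for n unfolding u_def by (induction n) (use t psi_T in auto)
    moreover have "u \<longlonglongrightarrow> (1, 0)"
    proof (rule metric_tendsto_imp_tendsto)
      have fixed: "psi_word c (replicate n 2) (1, 0) = (1, 0)" for n
        by (induction n) (auto simp: psi_ends)
      show "(\<lambda>n. dist t (1, 0) * (1 / 2) ^ n) \<longlonglongrightarrow> 0"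
        by (intro tendsto_mult_right_zero LIMSEQ_realpow_zero) auto
      show "\<forall>\<^sub>F n in sequentially. dist (u n) (1, 0) \<le> dist (dist t (1, 0) * (1 / 2) ^ n) 0"
        using dist_psi_word[of "replicate n 2" t "(1, 0)" for n]
        by (intro always_eventually allI) (simp add: u_def fixed power_divide)
    qed
    ultimately show ?thesis
      using closed_sequentially[OF compact_imp_closed[OF T(1)]] by blast
  qed
  moreover from this have "(0, 0) \<in> T" using psi_T[of 1 "(1, 0)"] psi_ends by simp
  ultimately have "vertices c n \<subseteq> T" for n
  proof (induction n)
    case (Suc n) then show ?case using psi_T unfolding vertices_Suc by blast
  qed (simp add: vertices_0)
  then show "closure (all_vertices c) \<subseteq> T"
    by (intro closure_minimal compact_imp_closed T(1)) (auto simp: all_vertices_def)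
  obtain B where B: "\<And>t. t \<in> T \<Longrightarrow> dist t (0, 0) \<le> B" 
    using compact_imp_bounded[OF T(1)] unfolding bounded_any_center[of T "(0, 0)"] by (metis dist_commute)
  have word: "\<exists>i\<in>words letters n. \<exists>t\<in>T. x = psi_word c i t" if "x \<in> T" for x n
    using that
  proof (induction n arbitrary: x)
    case (Suc n)
    obtain k y where y: "k \<in> letters" "y \<in> T" "x = psi c k y" using Suc.prems T(3) by blast
    obtain i t where i: "i \<in> words letters n" "t \<in> T" "y = psi_word c i t" using Suc.IH[OF y(2)] by blast
    have "k # i \<in> words letters (Suc n)" using i y unfolding words_Suc by blast
    moreover have "x = psi_word c (k # i) t" using i y by simp
    ultimately show ?case using i(2) by blast
  qed auto
  show "T \<subseteq> closure (all_vertices c)"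
  proof
    fix x assume x: "x \<in> T"
    show "x \<in> closure (all_vertices c)"
      unfolding closure_approachable
    proof (intro allI impI)
      fix e :: real assume e: "e > 0"
      have "(\<lambda>n. B * (1 / 2) ^ n) \<longlonglongrightarrow> 0"
        by (intro tendsto_mult_right_zero LIMSEQ_realpow_zero) auto
      then have "\<forall>\<^sub>F n in sequentially. B * (1 / 2) ^ n < e" using e by (rule order_tendstoD)
      then obtain n where n: "B * (1 / 2) ^ n < e" by (auto simp: eventually_sequentially)
      obtain i t where i: "i \<in> words letters n" "t \<in> T" "x = psi_word c i t" using word[OF x] by blast
      have "dist (psi_word c i (0, 0)) x \<le> dist t (0, 0) / 2 ^ n"
        using dist_psi_word[of i "(0, 0)" t] i by (simp add: words_def dist_commute)
      also have "\<dots> \<le> B / 2 ^ n" using B[OF i(2)] by (intro divide_right_mono) auto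
      finally have "dist (psi_word c i (0, 0)) x < e" using n by (simp add: power_divide)
      then show "\<exists>y\<in>all_vertices c. dist y x < e"
        using edge_vertices(1)[OF i(1)] unfolding all_vertices_def by blast
    qed
  qed
qed

end

text \<open>All that the topological part has to know about one realisation. The level bounds are to
  be summable because a path into the depth of a cell picks up an edge of each further
  level.\<close>

locale weighted_dendrite = dendrite +
  fixes v :: "nat list \<Rightarrow> real" and s :: "nat \<Rightarrow> real"
  assumes weights: "consistent (\<lambda>i. edge_length v i * cascade_limit v i)"
    and weight_le: "\<And>i. i \<in> lists letters \<Longrightarrow> edge_length v i * cascade_limit v i \<le> s (length i)"
    and summable_s: "summable s"
begin

section \<open>Resistance estimates for one realisation\<close>

abbreviation "weight \<equiv> \<lambda>i. edge_length v i * cascade_limit v i"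

lemma common_level:
  assumes "finite A" "A \<subseteq> all_vertices c"
  obtains n where "A \<subseteq> vertices c n" "N \<le> n"
proof -
  have "\<exists>n\<ge>N. A \<subseteq> vertices c n"
    using assms
  proof (induction A)
    case (insert x A)
    obtain n where n: "N \<le> n" "A \<subseteq> vertices c n" using insert by blast
    obtain m where m: "x \<in> vertices c m" using insert unfolding all_vertices_def by blast
    show ?case
      using n m vertices_mono[of n "max n m"] vertices_mono[of m "max n m"]
      by (intro exI[of _ "max n m"]) auto
  qed auto
  then show ?thesis using that by blast
qed

lemma resistance_nonneg:
  assumes "x \<in> all_vertices c" "y \<in> all_vertices c"
  shows "0 \<le> resistance c v x y"
proof -
  obtain n where "{x, y} \<subseteq> vertices c n" using common_level[of "{x, y}"] assms by auto
  then show ?thesis using resistance_eq_tdist[OF weights, of _ n] tdist_nonneg[OF weights] by simp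
qed

lemma resistance_commute:
  assumes "x \<in> all_vertices c" "y \<in> all_vertices c"
  shows "resistance c v x y = resistance c v y x"
proof -
  obtain n where "{x, y} \<subseteq> vertices c n" using common_level[of "{x, y}"] assms by auto
  then show ?thesis
    using resistance_eq_tdist[OF weights, of _ n] tdist_commute[of _ n x y] by simp
qed

lemma resistance_triangle:
  assumes "x \<in> all_vertices c" "y \<in> all_vertices c" "z \<in> all_vertices c"
  shows "resistance c v x z \<le> resistance c v x y + resistance c v y z"
proof -
  obtain n where "{x, y, z} \<subseteq> vertices c n" using common_level[of "{x, y, z}"] assms by auto
  then show ?thesis
    using resistance_eq_tdist[OF weights, of _ n] tdist_triangle[OF weights, of n x z y] by simp
qed

text \<open>Close points lie in touching cells of a fixed level, so four legs join them: from
  \<open>x\<close> to the \<open>(0, 0)\<close> end of its cell, on to a common vertex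
  \<open>p\<close>, to the end of the other cell, and to \<open>y\<close>. Each leg is below
  \<open>e / 4\<close> by a tail of the series of \<open>s\<close>.\<close>

lemma resistance_small:
  assumes "0 < e"
  shows "\<exists>d>0. \<forall>x\<in>all_vertices c. \<forall>y\<in>all_vertices c. dist x y < d \<longrightarrow> resistance c v x y < e"
proof -
  have "0 < e / 4" using assms by simp
  then obtain N where N: "\<And>m n. N \<le> m \<Longrightarrow> norm (sum s {m..<n}) < e / 4"
    using summable_s unfolding summable_Cauchy by blast
  obtain d where d: "d > 0" "\<forall>i\<in>words letters N. \<forall>j\<in>words letters N.
      \<forall>x\<in>psi_word c i ` rhombus. \<forall>y\<in>psi_word c j ` rhombus. dist x y < d \<longrightarrow>
        psi_word c i ` rhombus \<inter> psi_word c j ` rhombus \<noteq> {}"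
    using cells_separated[of N] by blast
  show ?thesis
  proof (intro exI[of _ d] conjI ballI impI)
    fix x y assume xy: "x \<in> all_vertices c" "y \<in> all_vertices c" "dist x y < d"
    obtain M where M: "{x, y} \<subseteq> vertices c M" "N \<le> M" using common_level[of "{x, y}" N] xy by auto
    define m where "m = M - N"
    have M': "M = N + m" using M by (simp add: m_def)
    obtain i j where ij: "i \<in> words letters N" "x \<in> psi_word c i ` vertices c m"
        "j \<in> words letters N" "y \<in> psi_word c j ` vertices c m"
      using M(1) unfolding M' vertices_add by blast
    have "vertices c m \<subseteq> rhombus" using vertices_rhombus by blast
    then have "x \<in> psi_word c i ` rhombus" "y \<in> psi_word c j ` rhombus"
      using ij(2,4) by blast+
    then have "psi_word c i ` rhombus \<inter> psi_word c j ` rhombus \<noteq> {}"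
      by (rule d(2)[rule_format, OF ij(1,3) _ _ xy(3)])
    moreover have "length i = length j" using ij by (simp add: words_def)
    ultimately have "psi_word c i ` vertices c 0 \<inter> psi_word c j ` vertices c 0 \<noteq> {}"
      by (intro touching_cells[OF words_lists[OF ij(1)] words_lists[OF ij(3)]])
    then obtain p where "p \<in> psi_word c i ` vertices c 0" "p \<in> psi_word c j ` vertices c 0"
      by blast
    then have p: "p \<in> psi_word c i ` vertices c m" "p \<in> psi_word c j ` vertices c m"
      using vertices_mono[of 0 m] by blast+
    let ?t = "tdist weight (N + m)"
    have le: "?t (psi_word c l (0, 0)) q < e / 4"
      if "l \<in> words letters N" "q \<in> psi_word c l ` vertices c m" for l q
    proof -
      have "(\<Sum>k<Suc m. s (N + k)) = sum s {N..<N + Suc m}"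
        by (rule sum.reindex_bij_witness[of _ "\<lambda>k. k - N" "\<lambda>k. N + k"]) auto
      then have "(\<Sum>k<Suc m. s (N + k)) < e / 4" using N[of N "N + Suc m"] by (simp add: abs_if split: if_splits)
      then show ?thesis using tdist_cell_le[OF weights weight_le that] by linarith
    qed
    have "?t x y \<le> ?t (psi_word c i (0, 0)) x + ?t (psi_word c i (0, 0)) p
        + ?t (psi_word c j (0, 0)) p + ?t (psi_word c j (0, 0)) y"
      using tdist_triangle[OF weights, of "N + m" x y p]
        tdist_triangle[OF weights, of "N + m" x p "psi_word c i (0, 0)"]
        tdist_triangle[OF weights, of "N + m" p y "psi_word c j (0, 0)"]
      by (simp add: tdist_commute[of _ _ x] tdist_commute[of _ _ p "psi_word c j (0, 0)"])
    also have "\<dots> < e" using le[OF ij(1,2)] le[OF ij(1) p(1)] le[OF ij(3) p(2)] le[OF ij(3,4)] by linarith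
    finally show "resistance c v x y < e"
      using resistance_eq_tdist[OF weights, of x "N + m" y] M(1) by (simp add: M')
  qed (rule d)
qed

text \<open>At level \<open>n\<close> the cells have diameter below a quarter of
  \<open>dist x y\<close>. If the cells of \<open>p\<close> and \<open>q\<close> met, four legs of
  less than a quarter each would join \<open>x\<close> to \<open>y\<close>. So these cells are
  disjoint, and a bound over the finitely many disjoint pairs suffices.\<close>

lemma resistance_separated:
  assumes "x \<noteq> y"
  shows "\<exists>d>0. \<forall>p\<in>all_vertices c. \<forall>q\<in>all_vertices c.
    dist p x < dist x y / 4 \<longrightarrow> dist q y < dist x y / 4 \<longrightarrow> d \<le> resistance c v p q"
proof -
  obtain B where B: "\<And>p q. p \<in> rhombus \<Longrightarrow> q \<in> rhombus \<Longrightarrow> dist p q \<le> B"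
    using compact_imp_bounded[OF compact_rhombus] unfolding bounded_two_points by blast
  have "(\<lambda>n. B * (1 / 2) ^ n) \<longlonglongrightarrow> 0"
    by (intro tendsto_mult_right_zero LIMSEQ_realpow_zero) auto
  moreover have "dist x y / 4 > 0" using assms by simp
  ultimately have "\<forall>\<^sub>F n in sequentially. B * (1 / 2) ^ n < dist x y / 4" by (rule order_tendstoD)
  then obtain n where n: "B * (1 / 2) ^ n < dist x y / 4" by (auto simp: eventually_sequentially)
  let ?D = "{(i, j) \<in> words letters n \<times> words letters n. psi_word c i ` rhombus \<inter> psi_word c j ` rhombus = {}}"
  have "\<exists>d>0. \<forall>(i, j)\<in>?D. \<forall>m. \<forall>p\<in>psi_word c i ` vertices c m. \<forall>q\<in>psi_word c j ` vertices c m.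
    d \<le> tdist weight (n + m) p q"
  proof (rule finite_uniform_pos)
    show "finite ?D" by (rule finite_subset[of _ "words letters n \<times> words letters n"]) auto
  next
    fix a assume "a \<in> ?D"
    then obtain i j where a: "a = (i, j)" "i \<in> words letters n" "j \<in> words letters n"
      "psi_word c i ` rhombus \<inter> psi_word c j ` rhombus = {}" by blast
    then show "\<exists>d>0. case a of (i, j) \<Rightarrow> \<forall>m. \<forall>p\<in>psi_word c i ` vertices c m. \<forall>q\<in>psi_word c j ` vertices c m.
        d \<le> tdist weight (n + m) p q"
      using tdist_cells_ge[OF weights, of i j] by (simp add: words_def)
  next
    fix a :: "nat list \<times> nat list" and e e' :: real
    assume "case a of (i, j) \<Rightarrow> \<forall>m. \<forall>p\<in>psi_word c i ` vertices c m. \<forall>q\<in>psi_word c j ` vertices c m.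
        e \<le> tdist weight (n + m) p q" "e' \<le> e"
    then show "case a of (i, j) \<Rightarrow> \<forall>m. \<forall>p\<in>psi_word c i ` vertices c m. \<forall>q\<in>psi_word c j ` vertices c m.
        e' \<le> tdist weight (n + m) p q"
      unfolding case_prod_unfold using order_trans by blast
  qed
  then obtain d where d: "d > 0" "\<forall>(i, j)\<in>?D. \<forall>m. \<forall>p\<in>psi_word c i ` vertices c m.
      \<forall>q\<in>psi_word c j ` vertices c m. d \<le> tdist weight (n + m) p q"
    by blast
  have diam: "dist p q < dist x y / 4"
    if i: "i \<in> words letters n" and pq: "p \<in> psi_word c i ` rhombus" "q \<in> psi_word c i ` rhombus" for i p q
  proof -
    obtain p' q' where p': "p' \<in> rhombus" "q' \<in> rhombus" "p = psi_word c i p'" "q = psi_word c i q'"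
      using pq by blast
    have "dist p q \<le> dist p' q' / 2 ^ n"
      using dist_psi_word[of i p' q'] i p' by (simp add: words_def)
    also have "\<dots> \<le> B / 2 ^ n" using B[OF p'(1,2)] by (intro divide_right_mono) auto
    finally have "dist p q \<le> B * (1 / 2) ^ n" by (simp add: power_divide)
    then show ?thesis using n by (rule le_less_trans)
  qed
  show ?thesis
  proof (intro exI[of _ d] conjI ballI impI)
    fix p q assume pq: "p \<in> all_vertices c" "q \<in> all_vertices c" "dist p x < dist x y / 4" "dist q y < dist x y / 4"
    obtain M where M: "{p, q} \<subseteq> vertices c M" "n \<le> M" using common_level[of "{p, q}" n] pq by auto
    define m where "m = M - n"
    have M': "M = n + m" using M by (simp add: m_def)
    obtain i j where ij: "i \<in> words letters n" "p \<in> psi_word c i ` vertices c m"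
        "j \<in> words letters n" "q \<in> psi_word c j ` vertices c m"
      using M(1) unfolding M' vertices_add by blast
    have "vertices c m \<subseteq> rhombus" using vertices_rhombus by blast
    then have pq': "p \<in> psi_word c i ` rhombus" "q \<in> psi_word c j ` rhombus" using ij by blast+
    have "psi_word c i ` rhombus \<inter> psi_word c j ` rhombus = {}"
    proof (rule ccontr)
      assume "psi_word c i ` rhombus \<inter> psi_word c j ` rhombus \<noteq> {}"
      then obtain u where u: "u \<in> psi_word c i ` rhombus" "u \<in> psi_word c j ` rhombus" by blast
      have "dist x y \<le> dist x p + dist p u + dist u q + dist q y"
        using dist_triangle[of x y p] dist_triangle[of p y u] dist_triangle[of u y q] by linarith
      moreover have "dist p u < dist x y / 4" "dist u q < dist x y / 4"
        using diam[OF ij(1) pq'(1) u(1)] diam[OF ij(3) u(2) pq'(2)] .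
      ultimately show False using pq(3,4) by (simp add: dist_commute)
    qed
    then have "(i, j) \<in> ?D" using ij by blast
    from bspec[OF d(2) this] have "\<forall>m. \<forall>p\<in>psi_word c i ` vertices c m. \<forall>q\<in>psi_word c j ` vertices c m.
        d \<le> tdist weight (n + m) p q"
      by (simp only: case_prod_conv)
    then have "d \<le> tdist weight (n + m) p q"
      using ij(2,4) by blast
    then show "d \<le> resistance c v p q"
      using resistance_eq_tdist[OF weights, of p "n + m" q] M(1) by (simp add: M')
  qed (rule d)
qed

theorem resistance_limit_metric:
  assumes T: "compact T" "T = closure (all_vertices c)"
  shows "(\<forall>x\<in>T. \<forall>y\<in>T. \<exists>!r. is_resistance_limit c v x y r)
    \<and> Metric_space T (limit_resistance c v T)
    \<and> Metric_space.mtopology T (limit_resistance c v T) = top_of_set T"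
proof -
  let ?V = "all_vertices c" and ?d = "resistance c v"
  \<comment> \<open>By the triangle inequality the resistance changes by at most the resistances
    between old and new arguments, which \<open>resistance_small\<close> controls. The continuous
    extension \<open>g\<close> is the candidate for the limit.\<close>
  have uc: "uniformly_continuous_on (?V \<times> ?V) (\<lambda>(x, y). ?d x y)"
    unfolding uniformly_continuous_on_def
  proof (intro allI impI)
    fix e :: real assume "e > 0"
    then obtain d where d: "d > 0" "\<And>x y. x \<in> ?V \<Longrightarrow> y \<in> ?V \<Longrightarrow> dist x y < d \<Longrightarrow> ?d x y < e / 2"
      using resistance_small[of "e / 2"] by auto
    have "dist (?d x' y') (?d x y) < e"
      if V: "x \<in> ?V" "y \<in> ?V" "x' \<in> ?V" "y' \<in> ?V" and lt: "dist (x', y') (x, y) < d" for x y x' y'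
    proof -
      have "dist x' x < d" "dist y' y < d"
        using lt dist_fst_le[of "(x', y')" "(x, y)"] dist_snd_le[of "(x', y')" "(x, y)"] by simp_all
      then have "?d x' x < e / 2" "?d y' y < e / 2" using d(2) V by blast+
      then show ?thesis
        using resistance_triangle[of x' x y'] resistance_triangle[of x y y'] resistance_triangle[of x x' y]
          resistance_triangle[of x' y' y] resistance_commute[of x x'] resistance_commute[of y y'] V
        unfolding dist_real_def by linarith
    qed
    then show "\<exists>d>0. \<forall>p\<in>?V \<times> ?V. \<forall>p'\<in>?V \<times> ?V. dist p' p < d \<longrightarrow>
       dist (case p' of (x, y) \<Rightarrow> ?d x y) (case p of (x, y) \<Rightarrow> ?d x y) < e"
      using d(1) by (intro exI[of _ d]) auto
  qed
  obtain g where "uniformly_continuous_on (closure (?V \<times> ?V)) g"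
    and gV: "\<And>p. p \<in> ?V \<times> ?V \<Longrightarrow> (case p of (x, y) \<Rightarrow> ?d x y) = g p"
    by (rule uniformly_continuous_on_extension_on_closure[OF uc]) (use that in blast)
  then have g: "continuous_on (T \<times> T) g"
    by (simp add: closure_Times T(2) uniformly_continuous_imp_continuous)
  have VT: "?V \<subseteq> T" unfolding T(2) by (rule closure_subset)
  have lim: "(\<lambda>n. ?d (xs n) (ys n)) \<longlonglongrightarrow> g (x, y)"
    if "x \<in> T" "y \<in> T" "range xs \<subseteq> ?V" "range ys \<subseteq> ?V" "xs \<longlonglongrightarrow> x" "ys \<longlonglongrightarrow> y" for x y xs ys
  proof -
    have "(\<lambda>n. g (xs n, ys n)) \<longlonglongrightarrow> g (x, y)"
      using that VT by (intro continuous_on_tendsto_compose[OF g] tendsto_Pair) (auto intro!: always_eventually)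
    moreover have "g (xs n, ys n) = ?d (xs n) (ys n)" for n
      using gV[of "(xs n, ys n)"] range_subsetD[OF that(3), of n] range_subsetD[OF that(4), of n] by auto
    ultimately show ?thesis by simp
  qed
  have seq: "\<exists>xs. range xs \<subseteq> ?V \<and> xs \<longlonglongrightarrow> x" if "x \<in> T" for x
    using that unfolding T(2) closure_sequential by blast
  \<comment> \<open>Approximating sequences exist because \<open>T\<close> is the closure; without
    them \<open>is_resistance_limit\<close> would hold vacuously for every \<open>r\<close>.\<close>
  have iff: "is_resistance_limit c v x y r \<longleftrightarrow> r = g (x, y)" if xy: "x \<in> T" "y \<in> T" for x y r
  proof
    assume r: "is_resistance_limit c v x y r"
    obtain xs ys where "range xs \<subseteq> ?V" "range ys \<subseteq> ?V" "xs \<longlonglongrightarrow> x" "ys \<longlonglongrightarrow> y" using seq xy by metis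
    then show "r = g (x, y)"
      using r lim[OF xy] LIMSEQ_unique unfolding is_resistance_limit_def by blast
  qed (use lim[OF xy] in \<open>auto simp: is_resistance_limit_def\<close>)
  have limit: "limit_resistance c v T x y = (if x \<in> T \<and> y \<in> T then g (x, y) else 0)" for x y
    unfolding limit_resistance_def by (auto simp: iff intro!: the_equality)
  have nonneg: "0 \<le> g (x, y)" if xy: "x \<in> T" "y \<in> T" for x y
  proof -
    obtain xs ys where s: "range xs \<subseteq> ?V" "range ys \<subseteq> ?V" "xs \<longlonglongrightarrow> x" "ys \<longlonglongrightarrow> y" using seq xy by metis
    show ?thesis
      using LIMSEQ_le_const[OF lim[OF xy s], of 0] resistance_nonneg s(1,2) by blast
  qed
  have comm: "g (x, y) = g (y, x)" if xy: "x \<in> T" "y \<in> T" for x y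
  proof -
    obtain xs ys where s: "range xs \<subseteq> ?V" "range ys \<subseteq> ?V" "xs \<longlonglongrightarrow> x" "ys \<longlonglongrightarrow> y" using seq xy by metis
    have "?d (xs n) (ys n) = ?d (ys n) (xs n)" for n using resistance_commute s by blast
    then show ?thesis
      using LIMSEQ_unique lim[OF xy s] lim[OF xy(2,1) s(2,1,4,3)] by simp
  qed
  have tri: "g (x, z) \<le> g (x, y) + g (y, z)" if xyz: "x \<in> T" "y \<in> T" "z \<in> T" for x y z
  proof -
    obtain xs ys zs where s: "range xs \<subseteq> ?V" "range ys \<subseteq> ?V" "range zs \<subseteq> ?V" "xs \<longlonglongrightarrow> x" "ys \<longlonglongrightarrow> y" "zs \<longlonglongrightarrow> z"
      using seq xyz by metis
    have "?d (xs n) (zs n) \<le> ?d (xs n) (ys n) + ?d (ys n) (zs n)" for n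
      using resistance_triangle s by blast
    then show ?thesis
      using LIMSEQ_le[OF lim[OF xyz(1,3) s(1,3,4,6)]
        tendsto_add[OF lim[OF xyz(1,2) s(1,2,4,5)] lim[OF xyz(2,3) s(2,3,5,6)]]] by blast
  qed
  have zero: "g (x, x) = 0" if x: "x \<in> T" for x
  proof -
    obtain xs where s: "range xs \<subseteq> ?V" "xs \<longlonglongrightarrow> x" using seq x by metis
    have "(\<lambda>n. ?d (xs n) (xs n)) \<longlonglongrightarrow> g (x, x)" using lim[OF x x s(1,1,2,2)] .
    then show ?thesis by (simp add: resistance_def LIMSEQ_const_iff)
  qed
  \<comment> \<open>Positivity at single pairs of vertices could be lost in the limit; the bound
    \<open>d\<close> is uniform near \<open>x\<close> and \<open>y\<close>.\<close>
  have pos: "0 < g (x, y)" if xy: "x \<in> T" "y \<in> T" "x \<noteq> y" for x y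
  proof -
    obtain d where d: "d > 0" "\<And>p q. p \<in> ?V \<Longrightarrow> q \<in> ?V \<Longrightarrow> dist p x < dist x y / 4 \<Longrightarrow>
        dist q y < dist x y / 4 \<Longrightarrow> d \<le> ?d p q"
      using resistance_separated[OF xy(3)] by blast
    obtain xs ys where s: "range xs \<subseteq> ?V" "range ys \<subseteq> ?V" "xs \<longlonglongrightarrow> x" "ys \<longlonglongrightarrow> y" using seq xy by metis
    have "dist x y / 4 > 0" using xy by simp
    then have "\<forall>\<^sub>F n in sequentially. dist (xs n) x < dist x y / 4"
      "\<forall>\<^sub>F n in sequentially. dist (ys n) y < dist x y / 4"
      using s(3,4) tendstoD by blast+
    then have "\<forall>\<^sub>F n in sequentially. d \<le> ?d (xs n) (ys n)"
      by eventually_elim (use d(2) s(1,2) in blast)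
    then have "d \<le> g (x, y)"
      using tendsto_lowerbound[OF lim[OF xy(1,2) s]] by simp
    then show ?thesis using d(1) by simp
  qed
  have M: "Metric_space T (limit_resistance c v T)"
  proof
    show "limit_resistance c v T x y = 0 \<longleftrightarrow> x = y" if "x \<in> T" "y \<in> T" for x y
      using that zero pos[of x y] by (cases "x = y") (auto simp: limit)
  qed (auto simp: limit nonneg comm tri)
  then interpret M: Metric_space T "limit_resistance c v T" .
  have "M.mtopology = top_of_set T"
    unfolding topology_eq M.openin_mtopology openin_euclidean_subtopology_iff
  proof (intro allI conj_cong refl iffI allI ballI impI)
    fix U x
    assume UT: "U \<subseteq> T" and "\<forall>x. x \<in> U \<longrightarrow> (\<exists>r>0. M.mball x r \<subseteq> U)" and x: "x \<in> U"
    then obtain r where r: "r > 0" "M.mball x r \<subseteq> U" by blast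
    have xT: "x \<in> T" using x UT by blast
    have "continuous_on T (\<lambda>y. g (x, y))"
      using xT by (intro continuous_on_compose2[OF g] continuous_intros) auto
    then obtain e where e: "e > 0" "\<And>y. y \<in> T \<Longrightarrow> dist y x < e \<Longrightarrow> dist (g (x, y)) (g (x, x)) < r"
      using xT r(1) unfolding continuous_on_iff by blast
    have "y \<in> U" if "y \<in> T" "dist y x < e" for y
    proof -
      have "y \<in> M.mball x r"
        using e(2)[OF that] xT that zero[OF xT] nonneg[OF xT that(1)]
        by (simp add: limit M.in_mball)
      then show ?thesis using r(2) by blast
    qed
    then show "\<exists>e>0. \<forall>y\<in>T. dist y x < e \<longrightarrow> y \<in> U" using e(1) by blast
  next
    fix U x
    assume UT: "U \<subseteq> T" and "\<forall>x\<in>U. \<exists>e>0. \<forall>y\<in>T. dist y x < e \<longrightarrow> y \<in> U" and x: "x \<in> U"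
    then obtain e where e: "e > 0" "\<And>y. y \<in> T \<Longrightarrow> dist y x < e \<Longrightarrow> y \<in> U" by blast
    have xT: "x \<in> T" using x UT by blast
    \<comment> \<open>On this compact set the continuous positive function \<open>g (x, _)\<close>
      is bounded below by some \<open>r > 0\<close>, so the resistance ball of radius
      \<open>r\<close> lies in the Euclidean ball.\<close>
    let ?C = "T - ball x e"
    have cont: "continuous_on ?C (\<lambda>y. g (x, y))"
      using xT by (intro continuous_on_compose2[OF g] continuous_intros) auto
    have "compact ?C" using T(1) by (intro compact_diff) auto
    have "\<exists>r>0. \<forall>y\<in>?C. r \<le> g (x, y)"
    proof (cases "?C = {}")
      case False
      obtain y where y: "y \<in> ?C" "\<forall>z\<in>?C. g (x, y) \<le> g (x, z)"
        using continuous_attains_inf[OF \<open>compact ?C\<close> False cont] by blast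
      have "0 < g (x, y)" using pos[OF xT, of y] y(1) e(1) by (cases "x = y") auto
      then show ?thesis using y(2) by blast
    next
      case True
      show ?thesis unfolding True by (rule exI[of _ 1]) simp
    qed
    then obtain r where r: "r > 0" "\<And>y. y \<in> ?C \<Longrightarrow> r \<le> g (x, y)" by blast
    have "M.mball x r \<subseteq> U"
    proof
      fix y assume "y \<in> M.mball x r"
      then have "y \<in> T" "g (x, y) < r" using xT by (auto simp: M.in_mball limit)
      then have "y \<in> ball x e" using r(2)[of y] by force
      then show "y \<in> U" using e(2)[OF \<open>y \<in> T\<close>] by (simp add: dist_commute)
    qed
    then show "\<exists>r>0. M.mball x r \<subseteq> U" using r(1) by blast
  qed
  then show ?thesis using M iff by auto
qed

end

section \<open>Moments of the cascade\<close>

text \<open>The sum over \<open>words {1, 2} n\<close> in \<open>cascade_limit\<close>, organised by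
  the first letter. This form has no division by \<open>edge_length\<close> and involves only
  weights below \<open>i\<close>, so measurability and independence can be read off.\<close>

fun partial_mass :: "(nat list \<Rightarrow> real) \<Rightarrow> nat \<Rightarrow> nat list \<Rightarrow> real" where
  "partial_mass v 0 i = 1"
| "partial_mass v (Suc n) i =
    v (i @ [1]) * partial_mass v n (i @ [1]) + v (i @ [2]) * partial_mass v n (i @ [2])"

definition mass :: "(nat list \<Rightarrow> real) \<Rightarrow> nat list \<Rightarrow> real" where
  "mass v i = lim (\<lambda>n. partial_mass v n i)"

text \<open>The sum over all words j of length n of the p-th powers of the edge lengths l(ij) R(ij),
  divided by l(i)^p. The embedding into the extended reals replaces a negative junk value of the limit
  by 0.\<close>

fun power_sum :: "(nat list \<Rightarrow> real) \<Rightarrow> nat \<Rightarrow> nat \<Rightarrow> nat list \<Rightarrow> ennreal" where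
  "power_sum v p 0 i = ennreal (mass v i) ^ p"
| "power_sum v p (Suc n) i = (\<Sum>k\<in>letters. ennreal (v (i @ [k]) ^ p) * power_sum v p n (i @ [k]))"

definition descendants :: "nat list \<Rightarrow> nat list set" where
  "descendants i = {i @ j |j. j \<in> lists letters}"

lemma descendants_self [simp]: "i \<in> descendants i"
  unfolding descendants_def by (auto intro!: exI[of _ "[]"])

lemma descendants_snoc: "k \<in> letters \<Longrightarrow> descendants (i @ [k]) \<subseteq> descendants i"
  unfolding descendants_def by auto

lemma descendants_lists: "i \<in> lists letters \<Longrightarrow> descendants i \<subseteq> lists letters"
  unfolding descendants_def by auto

section \<open>Independence of a triple and the subtrees below it\<close>

locale cascade = prob_space M for M :: "'a measure" +
  fixes w :: "nat list \<Rightarrow> 'a \<Rightarrow> real"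
  assumes w_measurable: "\<And>i. i \<in> lists letters - {[]} \<Longrightarrow> w i \<in> borel_measurable M"
    and w_range: "\<And>i \<omega>. i \<in> lists letters - {[]} \<Longrightarrow> \<omega> \<in> space M \<Longrightarrow> w i \<omega> \<in> {0..1}"
    and w_nonzero: "\<And>i. i \<in> lists letters - {[]} \<Longrightarrow> AE \<omega> in M. w i \<omega> \<noteq> 0"
    and w_indep: "indep_vars (\<lambda>_. borel)
           (\<lambda>i \<omega>. (w (i @ [1]) \<omega>, w (i @ [2]) \<omega>, w (i @ [3]) \<omega>)) (lists letters)"
    and w_ident: "\<And>i. i \<in> lists letters \<Longrightarrow>
           distr M borel (\<lambda>\<omega>. (w (i @ [1]) \<omega>, w (i @ [2]) \<omega>, w (i @ [3]) \<omega>))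
           = distr M borel (\<lambda>\<omega>. (w [1] \<omega>, w [2] \<omega>, w [3] \<omega>))"
    and w_mean: "expectation (\<lambda>\<omega>. w [1] \<omega> + w [2] \<omega>) = 1"
begin

definition triple :: "nat list \<Rightarrow> 'a \<Rightarrow> real \<times> real \<times> real" where
  "triple i \<omega> = (w (i @ [1]) \<omega>, w (i @ [2]) \<omega>, w (i @ [3]) \<omega>)"

text \<open>The sigma-algebra generated by the triples at addresses in \<open>A\<close>. A triple
  sits at the parent: \<open>w (i @ [k])\<close> belongs to \<open>info {i}\<close>, while
  \<open>info (descendants (i @ [k]))\<close> sees only weights strictly below
  \<open>i @ [k]\<close>.\<close>

definition info :: "nat list set \<Rightarrow> 'a measure" where
  "info A = vimage_algebra (space M) (\<lambda>\<omega>. \<lambda>i\<in>A. triple i \<omega>) (PiM A (\<lambda>_. borel))"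

lemma w_child:
  assumes "i \<in> lists letters" "k \<in> letters"
  shows "w (i @ [k]) \<in> borel_measurable M"
    and "\<omega> \<in> space M \<Longrightarrow> 0 \<le> w (i @ [k]) \<omega>"
    and "\<omega> \<in> space M \<Longrightarrow> w (i @ [k]) \<omega> \<le> 1"
    and "AE \<omega> in M. 0 < w (i @ [k]) \<omega>"
proof -
  have i: "i @ [k] \<in> lists letters - {[]}" using assms by auto
  show "w (i @ [k]) \<in> borel_measurable M" using w_measurable[OF i] .
  show "\<omega> \<in> space M \<Longrightarrow> 0 \<le> w (i @ [k]) \<omega>" "\<omega> \<in> space M \<Longrightarrow> w (i @ [k]) \<omega> \<le> 1"
    using w_range[OF i] by auto
  show "AE \<omega> in M. 0 < w (i @ [k]) \<omega>"
    using w_nonzero[OF i] AE_space by eventually_elim (use w_range[OF i] in force)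
qed

lemma space_info [simp]: "space (info A) = space M"
  by (simp add: info_def)

lemma triple_measurable: "i \<in> lists letters \<Longrightarrow> triple i \<in> borel_measurable M"
  using w_child(1) unfolding triple_def by (intro borel_measurable_Pair) simp_all

lemma info_triple:
  assumes "i \<in> A" shows "triple i \<in> borel_measurable (info A)"
proof -
  have "(\<lambda>\<omega>. \<lambda>i\<in>A. triple i \<omega>) \<in> measurable (info A) (PiM A (\<lambda>_. borel))"
    unfolding info_def by (rule measurable_vimage_algebra1) (simp add: space_PiM)
  from measurable_compose[OF this measurable_component_singleton[OF assms]]
  show ?thesis using assms by simp
qed

lemma info_mono:
  assumes "A \<subseteq> B" "f \<in> measurable (info A) N"
  shows "f \<in> measurable (info B) N"
proof -
  have "(\<lambda>\<omega>. \<lambda>i\<in>A. triple i \<omega>) \<in> measurable (info B) (PiM A (\<lambda>_. borel))"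
    by (intro measurable_restrict info_triple) (use assms in auto)
  then have "(\<lambda>\<omega>. \<omega>) \<in> measurable (info B) (info A)"
    unfolding info_def[of A] by (intro measurable_vimage_algebra2) simp
  from measurable_compose[OF this assms(2)] show ?thesis .
qed

lemma info_measurable:
  assumes "A \<subseteq> lists letters" "f \<in> measurable (info A) N"
  shows "f \<in> measurable M N"
proof -
  have "(\<lambda>\<omega>. \<lambda>i\<in>A. triple i \<omega>) \<in> measurable M (PiM A (\<lambda>_. borel))"
    by (intro measurable_restrict triple_measurable) (use assms in auto)
  then have "(\<lambda>\<omega>. \<omega>) \<in> measurable M (info A)"
    unfolding info_def[of A] by (intro measurable_vimage_algebra2) simp
  from measurable_compose[OF this assms(2)] show ?thesis .
qed

lemma info_w:
  assumes "i \<in> A" "k \<in> letters" shows "w (i @ [k]) \<in> borel_measurable (info A)"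
proof -
  note t = info_triple[OF assms(1)]
  have "(\<lambda>\<omega>. fst (triple i \<omega>)) \<in> borel_measurable (info A)"
    "(\<lambda>\<omega>. fst (snd (triple i \<omega>))) \<in> borel_measurable (info A)"
    "(\<lambda>\<omega>. snd (snd (triple i \<omega>))) \<in> borel_measurable (info A)"
    by (rule measurable_compose[OF t], intro borel_measurable_continuous_onI continuous_intros)+
  then show ?thesis using assms(2) by (auto simp: triple_def)
qed

text \<open>The triple at \<open>i\<close> and the subtrees of its children use disjoint sets of
  addresses, and grouping preserves independence. Index 0, which is not a letter, stands for the
  triple as a whole, whose entries may depend on each other.\<close>

lemma indep_branches:
  fixes X :: "nat \<Rightarrow> 'a \<Rightarrow> 'b::topological_space"
  assumes i: "i \<in> lists letters" and X0: "X 0 \<in> borel_measurable (info {i})"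
    and X: "\<And>k. k \<in> letters \<Longrightarrow> X k \<in> borel_measurable (info (descendants (i @ [k])))"
  shows "indep_vars (\<lambda>_. borel) X {0, 1, 2, 3}"
proof -
  define K where "K k = (if k = 0 then {i} else descendants (i @ [k]))" for k :: nat
  let ?L = "{0, 1, 2, 3} :: nat set"
  have K: "K k \<subseteq> lists letters" if "k \<in> ?L" for k
    using that i descendants_lists[of "i @ [k]"] by (auto simp: K_def)
  have "disjoint_family_on K ?L"
    unfolding disjoint_family_on_def K_def descendants_def by auto
  then have "indep_vars (\<lambda>k. PiM (K k) (\<lambda>_. borel)) (\<lambda>k \<omega>. \<lambda>i\<in>K k. triple i \<omega>) ?L"
    unfolding triple_def by (intro indep_vars_restrict[OF w_indep] K)
  then have ind: "indep_sets (\<lambda>k. {(\<lambda>\<omega>. \<lambda>i\<in>K k. triple i \<omega>) -` A \<inter> space M |A.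
      A \<in> sets (PiM (K k) (\<lambda>_. borel))}) ?L"
    unfolding indep_vars_def2 by blast
  have XK: "X k \<in> borel_measurable (info (K k))" if "k \<in> ?L" for k
    using X0 X[of k] that by (auto simp: K_def)
  have "indep_sets (\<lambda>k. {X k -` A \<inter> space M |A. A \<in> sets borel}) ?L"
  proof (rule indep_sets_mono_sets[OF ind])
    fix k assume k: "k \<in> ?L"
    show "{X k -` A \<inter> space M |A. A \<in> sets borel} \<subseteq>
      {(\<lambda>\<omega>. \<lambda>i\<in>K k. triple i \<omega>) -` A \<inter> space M |A. A \<in> sets (PiM (K k) (\<lambda>_. borel))}"
    proof clarify
      fix A :: "'b set" assume A: "A \<in> sets borel"
      have "X k -` A \<inter> space M \<in> sets (info (K k))"
        using measurable_sets[OF XK[OF k] A] by simp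
      then show "\<exists>B. X k -` A \<inter> space M = (\<lambda>\<omega>. \<lambda>i\<in>K k. triple i \<omega>) -` B \<inter> space M \<and>
          B \<in> sets (PiM (K k) (\<lambda>_. borel))"
        unfolding info_def by (subst (asm) sets_vimage_algebra2) (auto simp: space_PiM)
    qed
  qed
  moreover have "X k \<in> borel_measurable M" if "k \<in> ?L" for k
    using info_measurable[OF K XK] that by blast
  ultimately show ?thesis unfolding indep_vars_def2 by blast
qed

lemma branch_expectation:
  assumes i: "i \<in> lists letters" and f: "f \<in> borel_measurable (info {i})"
    and g: "g \<in> borel_measurable (info (descendants (i @ [1])))"
    and h: "h \<in> borel_measurable (info (descendants (i @ [2])))"
    and int: "integrable M f" "integrable M g" "integrable M h"
  shows "expectation (\<lambda>\<omega>. f \<omega> * (g \<omega> * h \<omega>)) = expectation f * (expectation g * expectation h)"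
    and "integrable M (\<lambda>\<omega>. f \<omega> * (g \<omega> * h \<omega>) :: real)"
proof -
  define X where "X k = (if k = 0 then f else if k = 1 then g else if k = 2 then h else (\<lambda>_. 1))" for k :: nat
  have ind: "indep_vars (\<lambda>_. borel) X {0, 1, 2, 3}"
    by (rule indep_branches[OF i]) (use f g h in \<open>auto simp: X_def\<close>)
  have X: "integrable M (X k)" for k using int by (simp add: X_def)
  show "expectation (\<lambda>\<omega>. f \<omega> * (g \<omega> * h \<omega>)) = expectation f * (expectation g * expectation h)"
    using indep_vars_lebesgue_integral[OF _ ind X] by (simp add: X_def prob_space)
  show "integrable M (\<lambda>\<omega>. f \<omega> * (g \<omega> * h \<omega>))"
    using indep_vars_integrable[OF _ ind X] by (simp add: X_def)
qed

lemma branch_nn_integral: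
  fixes f g :: "'a \<Rightarrow> ennreal"
  assumes i: "i \<in> lists letters" and f: "f \<in> borel_measurable (info {i})" and k: "k \<in> letters"
    and g: "g \<in> borel_measurable (info (descendants (i @ [k])))"
  shows "(\<integral>\<^sup>+\<omega>. f \<omega> * g \<omega> \<partial>M) = (\<integral>\<^sup>+\<omega>. f \<omega> \<partial>M) * (\<integral>\<^sup>+\<omega>. g \<omega> \<partial>M)"
proof -
  define X where "X l = (if l = 0 then f else if l = k then g else (\<lambda>_. 1))" for l :: nat
  have "indep_vars (\<lambda>_. borel) X {0, 1, 2, 3}"
    by (rule indep_branches[OF i]) (use f g in \<open>auto simp: X_def\<close>)
  from indep_vars_nn_integral[OF _ this] k show ?thesis
    by (auto simp: X_def emeasure_space_1)
qed

section \<open>Moments of the finite sums\<close>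

lemma integrable_bounded_variable:
  fixes f :: "'a \<Rightarrow> real"
  assumes "f \<in> borel_measurable M" "\<And>\<omega>. \<omega> \<in> space M \<Longrightarrow> \<bar>f \<omega>\<bar> \<le> B"
  shows "integrable M f"
  by (rule integrable_const_bound[of _ B]) (use assms in auto)

text \<open>Both powers stay under one expectation because the entries of a triple may be
  dependent.\<close>

definition mixed_moment :: "nat \<Rightarrow> nat \<Rightarrow> real" where
  "mixed_moment a b = expectation (\<lambda>\<omega>. w [1] \<omega> ^ a * w [2] \<omega> ^ b)"

lemma triple_distr:
  assumes "i \<in> lists letters"
  shows "distr M borel (triple i) = distr M borel (triple [])"
  using w_ident[OF assms] unfolding triple_def by simp

lemma mixed_moment:
  assumes "i \<in> lists letters"
  shows "expectation (\<lambda>\<omega>. w (i @ [1]) \<omega> ^ a * w (i @ [2]) \<omega> ^ b) = mixed_moment a b"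
proof -
  let ?F = "\<lambda>t :: real \<times> real \<times> real. fst t ^ a * fst (snd t) ^ b"
  have F: "?F \<in> borel_measurable borel"
    by (intro borel_measurable_continuous_onI continuous_intros)
  have "expectation (\<lambda>\<omega>. ?F (triple i \<omega>)) = expectation (\<lambda>\<omega>. ?F (triple [] \<omega>))"
    using triple_distr[OF assms] integral_distr[OF triple_measurable[OF assms] F]
      integral_distr[OF triple_measurable[of "[]"] F] by simp
  then show ?thesis by (simp add: triple_def mixed_moment_def)
qed

lemma child_moment:
  assumes i: "i \<in> lists letters" and k: "k \<in> letters"
  shows "(\<integral>\<^sup>+\<omega>. ennreal (w (i @ [k]) \<omega> ^ p) \<partial>M) = ennreal (expectation (\<lambda>\<omega>. w [k] \<omega> ^ p))"
proof -
  define pr where "pr t = (if k = 1 then fst t else if k = 2 then fst (snd t) else snd (snd t))"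
    for t :: "real \<times> real \<times> real"
  have pr: "pr \<in> borel_measurable borel"
    unfolding pr_def
    by (cases "k = 1"; cases "k = 2"; simp;
        intro borel_measurable_continuous_onI continuous_intros)
  then have F: "(\<lambda>t. ennreal (pr t ^ p)) \<in> borel_measurable (distr M borel (triple j))" for j
    by simp
  have w: "pr (triple j \<omega>) = w (j @ [k]) \<omega>" for j \<omega> using k by (auto simp: pr_def triple_def)
  have "(\<integral>\<^sup>+\<omega>. ennreal (pr (triple i \<omega>) ^ p) \<partial>M) = (\<integral>\<^sup>+\<omega>. ennreal (pr (triple [] \<omega>) ^ p) \<partial>M)"
    using triple_distr[OF i] nn_integral_distr[OF triple_measurable[OF i] F]
      nn_integral_distr[OF triple_measurable[of "[]"] F] by simp
  also have "\<dots> = ennreal (expectation (\<lambda>\<omega>. w [k] \<omega> ^ p))"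
    unfolding w append_Nil using w_child[of "[]" k, unfolded append_Nil] k
    by (intro nn_integral_eq_integral integrable_bounded_variable[of _ 1])
      (auto simp: power_abs abs_le_iff intro!: power_le_one)
  finally show ?thesis unfolding w .
qed

abbreviation tot :: "nat \<Rightarrow> nat list \<Rightarrow> 'a \<Rightarrow> real" where
  "tot n i \<omega> \<equiv> partial_mass (\<lambda>i. w i \<omega>) n i"

abbreviation lim_tot :: "nat list \<Rightarrow> 'a \<Rightarrow> real" where
  "lim_tot i \<omega> \<equiv> mass (\<lambda>i. w i \<omega>) i"

lemma tot_measurable_info: "tot n i \<in> borel_measurable (info (descendants i))"
proof (induction n arbitrary: i)
  case (Suc n)
  have "w (i @ [k]) \<in> borel_measurable (info (descendants i))"
    "tot n (i @ [k]) \<in> borel_measurable (info (descendants i))" if "k \<in> letters" for k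
    using info_w[of i "descendants i" k] info_mono[OF descendants_snoc[OF that] Suc.IH] that by auto
  then show ?case by simp
qed simp

lemma lim_tot_measurable_info: "lim_tot i \<in> borel_measurable (info (descendants i))"
  unfolding mass_def using tot_measurable_info by measurable

lemma tot_measurable: "i \<in> lists letters \<Longrightarrow> tot n i \<in> borel_measurable M"
  using info_measurable[OF descendants_lists tot_measurable_info] .

lemma lim_tot_measurable: "i \<in> lists letters \<Longrightarrow> lim_tot i \<in> borel_measurable M"
  using info_measurable[OF descendants_lists lim_tot_measurable_info] .

lemma tot_bounds:
  "i \<in> lists letters \<Longrightarrow> \<omega> \<in> space M \<Longrightarrow> 0 \<le> tot n i \<omega> \<and> tot n i \<omega> \<le> 2 ^ n"
proof (induction n arbitrary: i)
  case (Suc n)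
  have "0 \<le> w (i @ [k]) \<omega> * tot n (i @ [k]) \<omega> \<and> w (i @ [k]) \<omega> * tot n (i @ [k]) \<omega> \<le> 1 * 2 ^ n"
    if "k \<in> letters" for k
    using Suc.IH[of "i @ [k]"] w_child(2,3)[OF Suc.prems(1) that Suc.prems(2)] Suc.prems that
    by (intro conjI mult_nonneg_nonneg mult_mono) auto
  from this[of 1] this[of 2] show ?case by simp
qed simp

lemma tot_power_integrable:
  assumes "i \<in> lists letters" shows "integrable M (\<lambda>\<omega>. tot n i \<omega> ^ p)"
  using tot_bounds[OF assms, of _ n] tot_measurable[OF assms, of n]
  by (intro integrable_bounded_variable[of _ "(2 ^ n) ^ p"]) (auto simp: power_abs intro!: power_mono)

lemma mixed_power_bounds:
  assumes "i \<in> lists letters" "\<omega> \<in> space M"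
  shows "0 \<le> w (i @ [1]) \<omega> ^ a * w (i @ [2]) \<omega> ^ b" "w (i @ [1]) \<omega> ^ a * w (i @ [2]) \<omega> ^ b \<le> 1"
  using w_child(2,3)[OF assms(1) _ assms(2), of 1] w_child(2,3)[OF assms(1) _ assms(2), of 2]
  by (auto intro!: mult_le_one power_le_one)

lemma mixed_power_integrable:
  assumes "i \<in> lists letters"
  shows "integrable M (\<lambda>\<omega>. w (i @ [1]) \<omega> ^ a * w (i @ [2]) \<omega> ^ b)"
proof (rule integrable_bounded_variable[of _ 1])
  show "(\<lambda>\<omega>. w (i @ [1]) \<omega> ^ a * w (i @ [2]) \<omega> ^ b) \<in> borel_measurable M"
    using w_child(1)[OF assms, of 1] w_child(1)[OF assms, of 2] by simp
qed (use mixed_power_bounds[OF assms] in auto)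

lemma mixed_power_info:
  "(\<lambda>\<omega>. w (i @ [1]) \<omega> ^ a * w (i @ [2]) \<omega> ^ b) \<in> borel_measurable (info {i})"
  using info_w[of i "{i}" 1] info_w[of i "{i}" 2] by simp

lemma mixed_moment_bounds: "0 \<le> mixed_moment a b" "mixed_moment a b \<le> 1"
proof -
  show "0 \<le> mixed_moment a b"
    unfolding mixed_moment_def using mixed_power_bounds(1)[of "[]"]
    by (intro integral_nonneg_AE) auto
  have "mixed_moment a b \<le> expectation (\<lambda>\<omega>. 1)"
    unfolding mixed_moment_def
    using mixed_power_bounds(2)[of "[]"] mixed_power_integrable[of "[]"]
    by (intro integral_mono) auto
  then show "mixed_moment a b \<le> 1" by (simp add: prob_space)
qed

lemma mixed_moment_le:
  assumes "a \<le> a'" "b \<le> b'" shows "mixed_moment a' b' \<le> mixed_moment a b"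
  unfolding mixed_moment_def
proof (rule integral_mono)
  fix \<omega> assume "\<omega> \<in> space M"
  then show "w [1] \<omega> ^ a' * w [2] \<omega> ^ b' \<le> w [1] \<omega> ^ a * w [2] \<omega> ^ b"
    using w_child(2,3)[of "[]" 1] w_child(2,3)[of "[]" 2] assms
    by (intro mult_mono power_decreasing) auto
qed (use mixed_power_integrable[of "[]"] in auto)

lemma mixed_moment_mean: "mixed_moment 1 0 + mixed_moment 0 1 = 1"
  using w_mean mixed_power_integrable[of "[]" 1 0] mixed_power_integrable[of "[]" 0 1]
  by (simp add: mixed_moment_def)

text \<open>The factor by which mean squared increments of the sums shrink per level; it also bounds
  the extreme coefficients in the recursion for higher moments.\<close>

definition second_moment :: real where
  "second_moment = mixed_moment 2 0 + mixed_moment 0 2"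

lemma second_moment_nonneg: "0 \<le> second_moment"
  unfolding second_moment_def using mixed_moment_bounds by simp

text \<open>The function \<open>?f\<close> is nonnegative with mean
  \<open>1 - second_moment\<close>. If this mean is not positive, \<open>?f\<close> vanishes almost
  surely, so both weights are 0 or 1, hence 1 because they are nonzero, and their sum 2 contradicts
  \<open>w_mean\<close>.\<close>

lemma second_moment_less_1: "second_moment < 1"
proof (rule ccontr)
  assume "\<not> second_moment < 1"
  let ?f = "\<lambda>\<omega>. (w [1] \<omega> - w [1] \<omega> ^ 2) + (w [2] \<omega> - w [2] \<omega> ^ 2)"
  note int = mixed_power_integrable[of "[]" 1 0] mixed_power_integrable[of "[]" 0 1]
    mixed_power_integrable[of "[]" 2 0] mixed_power_integrable[of "[]" 0 2]
  have int': "integrable M ?f" using int by simp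
  have "expectation ?f = (mixed_moment 1 0 - mixed_moment 2 0) + (mixed_moment 0 1 - mixed_moment 0 2)"
    using int by (simp add: mixed_moment_def)
  then have le: "expectation ?f \<le> 0"
    using \<open>\<not> second_moment < 1\<close> mixed_moment_mean unfolding second_moment_def by simp
  have pos: "0 \<le> w [k] \<omega> - w [k] \<omega> ^ 2" if "k \<in> letters" "\<omega> \<in> space M" for k \<omega>
    using w_child(2,3)[of "[]" k \<omega>] that by (auto simp: power2_eq_square mult_left_le)
  then have nonneg: "0 \<le> ?f \<omega>" if "\<omega> \<in> space M" for \<omega>
    using that by (intro add_nonneg_nonneg) auto
  have "0 \<le> expectation ?f" by (intro integral_nonneg_AE AE_I2) (use nonneg in auto)
  with le have "expectation ?f = 0" by (rule antisym)
  then have "AE \<omega> in M. ?f \<omega> = 0"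
    using integral_nonneg_eq_0_iff_AE[OF int'] nonneg by auto
  then have "AE \<omega> in M. w [1] \<omega> + w [2] \<omega> = 2"
    using w_child(4)[of "[]" 1, simplified] w_child(4)[of "[]" 2, simplified] AE_space
  proof eventually_elim
    case (elim \<omega>)
    then have "w [1] \<omega> - w [1] \<omega> ^ 2 = 0" "w [2] \<omega> - w [2] \<omega> ^ 2 = 0"
      using pos[of 1 \<omega>] pos[of 2 \<omega>] by auto
    then show ?case using elim by (auto simp: power2_eq_square)
  qed
  then have "expectation (\<lambda>\<omega>. w [1] \<omega> + w [2] \<omega>) = expectation (\<lambda>\<omega>. 2)"
    using w_child(1)[of "[]" 1] w_child(1)[of "[]" 2] by (intro integral_cong_AE) auto
  then show False using w_mean by (simp add: prob_space)
qed

lemma tot_product: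
  assumes i: "i \<in> lists letters"
    and g: "g \<in> borel_measurable (info (descendants (i @ [1])))" "integrable M g"
    and h: "h \<in> borel_measurable (info (descendants (i @ [2])))" "integrable M h"
  shows "expectation (\<lambda>\<omega>. w (i @ [1]) \<omega> ^ a * w (i @ [2]) \<omega> ^ b * (g \<omega> * h \<omega>)) =
      mixed_moment a b * (expectation g * expectation h)"
    and "integrable M (\<lambda>\<omega>. w (i @ [1]) \<omega> ^ a * w (i @ [2]) \<omega> ^ b * (g \<omega> * h \<omega>))"
  using branch_expectation[OF i mixed_power_info[of i a b] g(1) h(1) mixed_power_integrable[OF i] g(2) h(2)]
  unfolding mixed_moment[OF i] by blast+

lemma snoc_lists: "i \<in> lists letters \<Longrightarrow> k \<in> letters \<Longrightarrow> i @ [k] \<in> lists letters"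
  by auto

lemma tot_moment_Suc:
  assumes i: "i \<in> lists letters"
  shows "expectation (\<lambda>\<omega>. tot (Suc n) i \<omega> ^ p) = (\<Sum>k\<le>p. real (p choose k) *
    (mixed_moment k (p - k) * (expectation (\<lambda>\<omega>. tot n (i @ [1]) \<omega> ^ k) *
      expectation (\<lambda>\<omega>. tot n (i @ [2]) \<omega> ^ (p - k)))))"
proof -
  let ?X = "\<lambda>k \<omega>. w (i @ [1]) \<omega> ^ k * w (i @ [2]) \<omega> ^ (p - k) *
      (tot n (i @ [1]) \<omega> ^ k * tot n (i @ [2]) \<omega> ^ (p - k))"
  have m: "(\<lambda>\<omega>. tot n (i @ [l]) \<omega> ^ q) \<in> borel_measurable (info (descendants (i @ [l])))" for l q
    using tot_measurable_info by measurable
  note X = tot_product[OF i m tot_power_integrable[OF snoc_lists[OF i]] m tot_power_integrable[OF snoc_lists[OF i]]]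
  have "expectation (\<lambda>\<omega>. tot (Suc n) i \<omega> ^ p) = expectation (\<lambda>\<omega>. \<Sum>k\<le>p. real (p choose k) * ?X k \<omega>)"
    by (simp add: binomial_ring power_mult_distrib mult_ac)
  also have "\<dots> = (\<Sum>k\<le>p. real (p choose k) * expectation (?X k))"
    using X(2) by (subst Bochner_Integration.integral_sum) auto
  finally show ?thesis using X(1) by simp
qed

lemma tot_mean: "i \<in> lists letters \<Longrightarrow> expectation (tot n i) = 1"
proof (induction n arbitrary: i)
  case (Suc n)
  have "expectation (\<lambda>\<omega>. tot (Suc n) i \<omega> ^ 1) = mixed_moment 0 1 + mixed_moment 1 0"
    unfolding tot_moment_Suc[OF Suc.prems]
    using Suc.IH[of "i @ [1]"] Suc.IH[of "i @ [2]"] Suc.prems by (simp add: prob_space)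
  then show ?case using mixed_moment_mean by simp
qed (simp add: prob_space)

text \<open>In the binomial expansion only the two extreme terms involve the p-th moment of the previous
  level, and their coefficients sum to less than 1.\<close>

lemma tot_moment_bounded:
  "\<exists>B\<ge>0. \<forall>n. \<forall>i\<in>lists letters. expectation (\<lambda>\<omega>. tot n i \<omega> ^ p) \<le> B"
proof (induction p rule: less_induct)
  case (less p)
  consider "p = 0" | "p = 1" | "p \<ge> 2" by linarith
  then show ?case
  proof cases
    case 1 then show ?thesis by (intro exI[of _ 1]) (auto simp: prob_space)
  next
    case 2 then show ?thesis using tot_mean by (intro exI[of _ 1]) auto
  next
    case 3
    obtain b where b: "\<And>q. q < p \<Longrightarrow> 0 \<le> b q"
      "\<And>q n i. q < p \<Longrightarrow> i \<in> lists letters \<Longrightarrow> expectation (\<lambda>\<omega>. tot n i \<omega> ^ q) \<le> b q"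
      using less by metis
    \<comment> \<open>\<open>D\<close> bounds the middle terms, where both exponents are below
      \<open>p\<close> and the mixed moment is at most 1. \<open>B\<close> is chosen to satisfy
      \<open>second_moment * B + D \<le> B\<close>, so that the bound reproduces itself, and
      \<open>B \<ge> 1\<close> covers level 0.\<close>
    define D where "D = (\<Sum>k\<in>{1..<p}. real (p choose k) * (b k * b (p - k)))"
    define B where "B = max 1 (D / (1 - second_moment))"
    have B: "0 \<le> B" by (simp add: B_def)
    have "D \<le> (1 - second_moment) * B"
    proof -
      have "D / (1 - second_moment) \<le> B" by (simp add: B_def)
      then show ?thesis using second_moment_less_1 by (simp add: pos_divide_le_eq mult.commute)
    qed
    have nonneg: "0 \<le> expectation (\<lambda>\<omega>. tot n i \<omega> ^ q)" if "i \<in> lists letters" for n i q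
      using tot_bounds[OF that] by (intro integral_nonneg_AE AE_I2) auto
    have "expectation (\<lambda>\<omega>. tot n i \<omega> ^ p) \<le> B" if "i \<in> lists letters" for n i
      using that
    proof (induction n arbitrary: i)
      case 0 then show ?case by (simp add: prob_space B_def)
    next
      case (Suc n)
      let ?E = "\<lambda>l q. expectation (\<lambda>\<omega>. tot n (i @ [l]) \<omega> ^ q)"
      let ?t = "\<lambda>k. real (p choose k) * (mixed_moment k (p - k) * (?E 1 k * ?E 2 (p - k)))"
      have il: "i @ [1] \<in> lists letters" "i @ [2] \<in> lists letters" using Suc.prems by auto
      have "{..p} = insert 0 (insert p {1..<p})" using 3 by auto
      then have "(\<Sum>k\<le>p. ?t k) = ?t 0 + ?t p + (\<Sum>k\<in>{1..<p}. ?t k)" using 3 by simp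
      moreover have "?t 0 \<le> mixed_moment 0 2 * B"
        using Suc.IH[OF il(2)] mixed_moment_le[of 0 0 2 p] 3 mixed_moment_bounds nonneg[OF il(2)] B
        by (auto simp: prob_space intro!: mult_mono)
      moreover have "?t p \<le> mixed_moment 2 0 * B"
        using Suc.IH[OF il(1)] mixed_moment_le[of 2 p 0 0] 3 mixed_moment_bounds nonneg[OF il(1)] B
        by (auto simp: prob_space intro!: mult_mono)
      moreover have "(\<Sum>k\<in>{1..<p}. ?t k) \<le> D"
        unfolding D_def
      proof (intro sum_mono mult_left_mono)
        fix k assume k: "k \<in> {1..<p}"
        have "?E 1 k * ?E 2 (p - k) \<le> b k * b (p - k)"
          using b il k nonneg by (intro mult_mono) auto
        moreover have "0 \<le> ?E 1 k * ?E 2 (p - k)" using nonneg il by simp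
        ultimately show "mixed_moment k (p - k) * (?E 1 k * ?E 2 (p - k)) \<le> b k * b (p - k)"
          using mult_right_mono[OF mixed_moment_bounds(2)[of k "p - k"]] by fastforce
      qed simp
      ultimately have "(\<Sum>k\<le>p. ?t k) \<le> second_moment * B + D"
        by (simp add: second_moment_def algebra_simps)
      also have "\<dots> \<le> B" using \<open>D \<le> (1 - second_moment) * B\<close> by (simp add: algebra_simps)
      finally show ?case unfolding tot_moment_Suc[OF Suc.prems] .
    qed
    then show ?thesis using B by blast
  qed
qed

end

text \<open>Young's inequality with a free scale \<open>r\<close>. It turns second moments into
  first moment bounds, once for the increments and once to isolate the event that the limit is
  nonzero.\<close>

lemma abs_le_square_plus:
  fixes x r :: real
  assumes "0 < r"
  shows "\<bar>x\<bar> \<le> 1 / (2 * r) * x ^ 2 + r / 2"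
proof -
  have "0 \<le> (\<bar>x\<bar> - r) ^ 2" by simp
  then have "2 * r * \<bar>x\<bar> \<le> x ^ 2 + r ^ 2" by (simp add: power2_diff mult.commute mult.left_commute)
  then show ?thesis using assms by (simp add: field_simps power2_eq_square)
qed

section \<open>Convergence of the sums through small increments\<close>

context cascade begin

abbreviation increment :: "nat \<Rightarrow> nat list \<Rightarrow> 'a \<Rightarrow> real" where
  "increment n i \<omega> \<equiv> tot (Suc n) i \<omega> - tot n i \<omega>"

lemma increment_Suc:
  "increment (Suc n) i \<omega> = w (i @ [1]) \<omega> * increment n (i @ [1]) \<omega> + w (i @ [2]) \<omega> * increment n (i @ [2]) \<omega>"
  by (simp add: algebra_simps)

declare partial_mass.simps(2) [simp del]

lemma tot_integrable: "i \<in> lists letters \<Longrightarrow> integrable M (tot n i)"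
  using tot_power_integrable[of i n 1] by simp

lemma increment_measurable_info: "increment n i \<in> borel_measurable (info (descendants i))"
  using tot_measurable_info[of "Suc n" i] tot_measurable_info[of n i] by simp

lemma increment_integrable: "i \<in> lists letters \<Longrightarrow> integrable M (increment n i)"
  using tot_integrable by simp

lemma increment_square_integrable:
  assumes i: "i \<in> lists letters" shows "integrable M (\<lambda>\<omega>. increment n i \<omega> ^ 2)"
proof (rule integrable_bounded_variable[of _ "(2 ^ Suc n) ^ 2"])
  show "(\<lambda>\<omega>. increment n i \<omega> ^ 2) \<in> borel_measurable M"
    using increment_integrable[OF i] by simp
  show "\<bar>increment n i \<omega> ^ 2\<bar> \<le> (2 ^ Suc n) ^ 2" if "\<omega> \<in> space M" for \<omega>
  proof -
    have "\<bar>increment n i \<omega>\<bar> \<le> 2 ^ Suc n"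
      using tot_bounds[OF i that, of n] tot_bounds[OF i that, of "Suc n"] by (simp add: abs_le_iff)
    then have "\<bar>increment n i \<omega>\<bar> ^ 2 \<le> (2 ^ Suc n) ^ 2" by (rule power_mono) simp
    then show ?thesis by simp
  qed
qed

lemma increment_mean: "i \<in> lists letters \<Longrightarrow> expectation (increment n i) = 0"
  using tot_mean tot_integrable by simp

text \<open>Increments of the two subtrees are independent and centred, so the cross term vanishes
  and each level contributes the factor \<open>second_moment\<close>.\<close>

lemma increment_second_moment:
  "i \<in> lists letters \<Longrightarrow> expectation (\<lambda>\<omega>. increment n i \<omega> ^ 2) \<le> second_moment ^ n"
proof (induction n arbitrary: i)
  case 0
  have "increment 0 i \<omega> ^ 2 \<le> 1" if "\<omega> \<in> space M" for \<omega>
  proof -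
    have "\<bar>increment 0 i \<omega>\<bar> \<le> 1"
      using w_child(2,3)[OF 0 _ that, of 1] w_child(2,3)[OF 0 _ that, of 2]
      by (simp add: partial_mass.simps(2) abs_le_iff)
    then show ?thesis by (simp add: abs_square_le_1)
  qed
  then have "expectation (\<lambda>\<omega>. increment 0 i \<omega> ^ 2) \<le> expectation (\<lambda>\<omega>. 1)"
    using increment_square_integrable[OF 0, of 0]
    by (intro integral_mono) (auto simp del: partial_mass.simps)
  then show ?case by (simp add: prob_space)
next
  case (Suc n)
  let ?D = "\<lambda>k. increment n (i @ [k])"
  have il: "i @ [1] \<in> lists letters" "i @ [2] \<in> lists letters" using Suc.prems by auto
  have m: "?D k \<in> borel_measurable (info (descendants (i @ [k])))"
    "(\<lambda>\<omega>. ?D k \<omega> ^ 2) \<in> borel_measurable (info (descendants (i @ [k])))" for k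
    using increment_measurable_info[of n "i @ [k]"] by simp_all
  have one: "(\<lambda>_. 1) \<in> borel_measurable (info X)" "integrable M (\<lambda>_. 1::real)"
    "expectation (\<lambda>_. 1::real) = 1" for X
    by (simp_all add: prob_space)
  note A = tot_product[where a = 2 and b = 0, OF Suc.prems m(2)[of 1] increment_square_integrable[OF il(1)] one(1,2),
      unfolded one(3) power_0 mult_1_right]
    and B = tot_product[where a = 0 and b = 2, OF Suc.prems one(1,2) m(2)[of 2] increment_square_integrable[OF il(2)],
      unfolded one(3) power_0 mult_1_left]
    and C = tot_product[where a = 1 and b = 1, OF Suc.prems m(1)[of 1] increment_integrable[OF il(1)] m(1)[of 2]
      increment_integrable[OF il(2)], unfolded increment_mean[OF il(1)] power_one_right mult_zero_left mult_zero_right]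
  have sum3: "expectation (\<lambda>\<omega>. f \<omega> + g \<omega> + 2 * h \<omega>) = expectation f + expectation g + 2 * expectation h"
    if "integrable M f" "integrable M g" "integrable M h" for f g h :: "'a \<Rightarrow> real"
    using that by simp
  have square: "(a * x + b * y) ^ 2 = a ^ 2 * x ^ 2 + b ^ 2 * y ^ 2 + 2 * (a * b * (x * y))" for a b x y :: real
    by (simp add: power2_eq_square algebra_simps)
  have "expectation (\<lambda>\<omega>. increment (Suc n) i \<omega> ^ 2) = mixed_moment 2 0 * expectation (\<lambda>\<omega>. ?D 1 \<omega> ^ 2)
      + mixed_moment 0 2 * expectation (\<lambda>\<omega>. ?D 2 \<omega> ^ 2) + 2 * 0"
    unfolding increment_Suc square sum3[OF A(2) B(2) C(2)] A(1) B(1) C(1) ..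
  also have "\<dots> \<le> mixed_moment 2 0 * second_moment ^ n + mixed_moment 0 2 * second_moment ^ n + 2 * 0"
    by (intro add_mono mult_left_mono Suc.IH[OF il(1)] Suc.IH[OF il(2)] mixed_moment_bounds order_refl)
  also have "\<dots> = second_moment ^ Suc n" by (simp add: second_moment_def algebra_simps)
  finally show ?case .
qed

text \<open>Averaging with 1 under the root keeps the rate strictly between 0 and 1 and at least the
  root of \<open>second_moment\<close>.\<close>

definition rate :: real where "rate = sqrt ((1 + second_moment) / 2)"

lemma rate: "0 < rate" "rate < 1" "second_moment \<le> rate ^ 2"
  using second_moment_nonneg second_moment_less_1 by (auto simp: rate_def)

text \<open>With the scale \<open>rate ^ n\<close> in \<open>abs_le_square_plus\<close>, each of the
  two terms has mean at most \<open>rate ^ n / 2\<close>.\<close>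

lemma increment_abs_mean:
  assumes i: "i \<in> lists letters"
  shows "expectation (\<lambda>\<omega>. \<bar>increment n i \<omega>\<bar>) \<le> rate ^ n"
proof -
  let ?r = "rate ^ n"
  have r: "?r > 0" using rate by simp
  have "\<bar>increment n i \<omega>\<bar> \<le> (1 / (2 * ?r)) * increment n i \<omega> ^ 2 + ?r / 2" for \<omega>
    by (rule abs_le_square_plus[OF r])
  then have "expectation (\<lambda>\<omega>. \<bar>increment n i \<omega>\<bar>) \<le> expectation (\<lambda>\<omega>. (1 / (2 * ?r)) * increment n i \<omega> ^ 2 + ?r / 2)"
    using increment_square_integrable[OF i] increment_integrable[OF i]
    by (intro integral_mono integrable_add integrable_abs integrable_mult_right) auto
  also have "\<dots> = (1 / (2 * ?r)) * expectation (\<lambda>\<omega>. increment n i \<omega> ^ 2) + ?r / 2"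
    using increment_square_integrable[OF i] by (simp add: prob_space)
  also have "\<dots> \<le> (1 / (2 * ?r)) * (rate ^ 2) ^ n + ?r / 2"
    using increment_second_moment[OF i, of n] power_mono[OF rate(3) second_moment_nonneg, of n] r
    by (intro add_right_mono mult_left_mono) auto
  also have "\<dots> = ?r" using r by (simp add: power2_eq_square power_mult_distrib)
  finally show ?thesis .
qed

text \<open>The expected sum of absolute increments is below a geometric series, so the sum is
  finite almost surely. The same L1 bound later carries the mean 1 over to the limit.\<close>

lemma increment_summable:
  assumes i: "i \<in> lists letters"
  shows "AE \<omega> in M. summable (\<lambda>n. \<bar>increment n i \<omega>\<bar>)"
proof -
  have meas: "(\<lambda>\<omega>. ennreal \<bar>increment n i \<omega>\<bar>) \<in> borel_measurable M" for n
    using increment_integrable[OF i] by measurable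
  have "(\<integral>\<^sup>+\<omega>. (\<Sum>n. ennreal \<bar>increment n i \<omega>\<bar>) \<partial>M) = (\<Sum>n. \<integral>\<^sup>+\<omega>. ennreal \<bar>increment n i \<omega>\<bar> \<partial>M)"
    by (rule nn_integral_suminf[OF meas])
  also have "\<dots> \<le> (\<Sum>n. ennreal (rate ^ n))"
  proof (rule suminf_le)
    show "(\<integral>\<^sup>+\<omega>. ennreal \<bar>increment n i \<omega>\<bar> \<partial>M) \<le> ennreal (rate ^ n)" for n
      using increment_abs_mean[OF i, of n] increment_integrable[OF i, of n]
      by (subst nn_integral_eq_integral) (auto intro!: ennreal_leI)
  qed auto
  also have "\<dots> = ennreal (\<Sum>n. rate ^ n)"
    using rate by (intro suminf_ennreal2) auto
  also have "\<dots> < \<infinity>" by simp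
  finally have "(\<integral>\<^sup>+\<omega>. (\<Sum>n. ennreal \<bar>increment n i \<omega>\<bar>) \<partial>M) \<noteq> \<infinity>" by simp
  then have "AE \<omega> in M. (\<Sum>n. ennreal \<bar>increment n i \<omega>\<bar>) \<noteq> \<infinity>"
    using meas by (intro nn_integral_PInf_AE) auto
  then show ?thesis
    by eventually_elim (auto intro: summable_suminf_not_top)
qed

lemma tot_eq_sum: "tot n i \<omega> = 1 + (\<Sum>k<n. increment k i \<omega>)"
  by (simp add: sum_lessThan_telescope[of "\<lambda>k. tot k i \<omega>"])

lemma tot_tendsto_sum:
  assumes i: "i \<in> lists letters"
  shows "AE \<omega> in M. (\<lambda>n. tot n i \<omega>) \<longlonglongrightarrow> 1 + (\<Sum>n. increment n i \<omega>)"
  using increment_summable[OF i]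
proof eventually_elim
  case (elim \<omega>)
  then have "summable (\<lambda>n. increment n i \<omega>)" by (rule summable_rabs_cancel)
  then have "(\<lambda>n. 1 + (\<Sum>k<n. increment k i \<omega>)) \<longlonglongrightarrow> 1 + (\<Sum>n. increment n i \<omega>)"
    by (intro tendsto_add tendsto_const summable_LIMSEQ)
  then show ?case unfolding tot_eq_sum[symmetric] .
qed

lemma lim_tot_eq:
  assumes i: "i \<in> lists letters"
  shows "AE \<omega> in M. lim_tot i \<omega> = 1 + (\<Sum>n. increment n i \<omega>)"
  using tot_tendsto_sum[OF i] by eventually_elim (simp add: mass_def limI)

lemma tot_tendsto:
  assumes i: "i \<in> lists letters"
  shows "AE \<omega> in M. (\<lambda>n. tot n i \<omega>) \<longlonglongrightarrow> lim_tot i \<omega>"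
  using tot_tendsto_sum[OF i] lim_tot_eq[OF i] by eventually_elim simp

lemma lim_tot_mean:
  assumes i: "i \<in> lists letters"
  shows "integrable M (lim_tot i)" "expectation (lim_tot i) = 1"
proof -
  have s: "summable (\<lambda>n. expectation (\<lambda>\<omega>. norm (increment n i \<omega>)))"
  proof (rule summable_comparison_test'[OF summable_geometric])
    show "norm rate < 1" using rate by simp
    show "norm (expectation (\<lambda>\<omega>. norm (increment n i \<omega>))) \<le> rate ^ n" for n
      using increment_abs_mean[OF i, of n] integral_nonneg_AE[of "\<lambda>\<omega>. norm (increment n i \<omega>)" M]
      by simp
  qed
  have s': "AE \<omega> in M. summable (\<lambda>n. norm (increment n i \<omega>))"
    using increment_summable[OF i] by simp
  note int = integrable_suminf[OF increment_integrable[OF i] s' s]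
    and exp = integral_suminf[OF increment_integrable[OF i] s' s]
  have eq: "AE \<omega> in M. lim_tot i \<omega> = 1 + (\<Sum>n. increment n i \<omega>)"
    by (rule lim_tot_eq[OF i])
  have int1: "integrable M (\<lambda>\<omega>. 1 + (\<Sum>n. increment n i \<omega>))" using int by simp
  show "integrable M (lim_tot i)"
    using integrable_cong_AE[OF lim_tot_measurable[OF i] _ eq] int1 by simp
  have "expectation (lim_tot i) = expectation (\<lambda>\<omega>. 1 + (\<Sum>n. increment n i \<omega>))"
    using int1 by (intro integral_cong_AE eq lim_tot_measurable[OF i]) auto
  also have "\<dots> = 1" using int exp increment_mean[OF i] by (simp add: prob_space)
  finally show "expectation (lim_tot i) = 1" .
qed

lemma lim_tot_nonneg: 
  assumes i: "i \<in> lists letters" shows "AE \<omega> in M. 0 \<le> lim_tot i \<omega>"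
  using tot_tendsto[OF i] AE_space
  by eventually_elim (use tot_bounds[OF i] in \<open>auto intro: LIMSEQ_le_const\<close>)

lemma lim_tot_step:
  assumes i: "i \<in> lists letters"
  shows "AE \<omega> in M. lim_tot i \<omega> = w (i @ [1]) \<omega> * lim_tot (i @ [1]) \<omega> + w (i @ [2]) \<omega> * lim_tot (i @ [2]) \<omega>"
proof -
  have il: "i @ [1] \<in> lists letters" "i @ [2] \<in> lists letters" using i by auto
  show ?thesis
    using tot_tendsto[OF i] tot_tendsto[OF il(1)] tot_tendsto[OF il(2)]
  proof eventually_elim
  case (elim \<omega>)
  have "(\<lambda>n. tot (Suc n) i \<omega>) \<longlonglongrightarrow> lim_tot i \<omega>" by (rule LIMSEQ_Suc[OF elim(1)])
  moreover have "(\<lambda>n. tot (Suc n) i \<omega>) \<longlonglongrightarrow> w (i @ [1]) \<omega> * lim_tot (i @ [1]) \<omega> + w (i @ [2]) \<omega> * lim_tot (i @ [2]) \<omega>"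
    unfolding partial_mass.simps(2) by (intro tendsto_intros elim)
  ultimately show ?case by (rule LIMSEQ_unique)
  qed
qed

section \<open>Moments and positivity of the limit\<close>

lemma lim_tot_moment_bounded:
  "\<exists>B\<ge>0. \<forall>i\<in>lists letters. (\<integral>\<^sup>+\<omega>. ennreal (lim_tot i \<omega>) ^ p \<partial>M) \<le> ennreal B"
proof -
  obtain B where B: "B \<ge> 0" "\<And>n i. i \<in> lists letters \<Longrightarrow> expectation (\<lambda>\<omega>. tot n i \<omega> ^ p) \<le> B"
    using tot_moment_bounded[of p] by blast
  have "(\<integral>\<^sup>+\<omega>. ennreal (lim_tot i \<omega>) ^ p \<partial>M) \<le> ennreal B" if i: "i \<in> lists letters" for i
  proof -
    \<comment> \<open>Written as a \<open>liminf\<close>, the limit inherits by Fatou's lemma the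
      moment bound that is uniform over levels and addresses.\<close>
    have "AE \<omega> in M. ennreal (lim_tot i \<omega>) ^ p = liminf (\<lambda>n. ennreal (tot n i \<omega> ^ p))"
      using tot_tendsto[OF i] lim_tot_nonneg[OF i]
    proof eventually_elim
      case (elim \<omega>)
      have "(\<lambda>n. ennreal (tot n i \<omega> ^ p)) \<longlonglongrightarrow> ennreal (lim_tot i \<omega> ^ p)"
        using elim by (intro tendsto_ennrealI tendsto_power)
      from lim_imp_Liminf[OF sequentially_bot this] show ?case
        using elim by (simp add: ennreal_power)
    qed
    then have "(\<integral>\<^sup>+\<omega>. ennreal (lim_tot i \<omega>) ^ p \<partial>M) = (\<integral>\<^sup>+\<omega>. liminf (\<lambda>n. ennreal (tot n i \<omega> ^ p)) \<partial>M)"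
      by (rule nn_integral_cong_AE)
    also have "\<dots> \<le> liminf (\<lambda>n. \<integral>\<^sup>+\<omega>. ennreal (tot n i \<omega> ^ p) \<partial>M)"
      using tot_measurable[OF i] by (intro nn_integral_liminf) measurable
    also have "\<dots> \<le> ennreal B"
    proof (rule Liminf_le[OF sequentially_bot always_eventually], rule allI)
      fix n show "(\<integral>\<^sup>+\<omega>. ennreal (tot n i \<omega> ^ p) \<partial>M) \<le> ennreal B"
        using B(2)[OF i, of n] tot_power_integrable[OF i] tot_bounds[OF i]
        by (subst nn_integral_eq_integral) (auto intro!: ennreal_leI)
    qed
    finally show ?thesis .
  qed
  then show ?thesis using B(1) by blast
qed

text \<open>Second moment method. The limit has mean 1 and second moment at most \<open>C\<close>,
  and where it is nonzero it is at most its square over \<open>2 * C\<close> plus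
  \<open>C / 2\<close>. Taking means, 1 is at most 1/2 plus \<open>C / 2\<close> times the
  probability of being nonzero, which is therefore at least \<open>1 / C\<close> at every
  address.\<close>

lemma lim_tot_zero_less:
  "\<exists>\<theta><1. 0 \<le> \<theta> \<and> (\<forall>i\<in>lists letters. prob {\<omega> \<in> space M. lim_tot i \<omega> = 0} \<le> \<theta>)"
proof -
  obtain B where B: "B \<ge> 0" "\<And>i. i \<in> lists letters \<Longrightarrow> (\<integral>\<^sup>+\<omega>. ennreal (lim_tot i \<omega>) ^ 2 \<partial>M) \<le> ennreal B"
    using lim_tot_moment_bounded[of 2] by blast
  define C where "C = max 1 B"
  have C: "C \<ge> 1" "B \<le> C" by (simp_all add: C_def)
  have "prob {\<omega> \<in> space M. lim_tot i \<omega> = 0} \<le> 1 - 1 / C" if i: "i \<in> lists letters" for i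
  proof -
    let ?Z = "{\<omega> \<in> space M. lim_tot i \<omega> = 0}"
    have Z: "?Z \<in> events" using lim_tot_measurable[OF i] by measurable
    have sq: "(\<integral>\<^sup>+\<omega>. ennreal (lim_tot i \<omega> ^ 2) \<partial>M) \<le> ennreal B"
    proof -
      have "(\<integral>\<^sup>+\<omega>. ennreal (lim_tot i \<omega> ^ 2) \<partial>M) = (\<integral>\<^sup>+\<omega>. ennreal (lim_tot i \<omega>) ^ 2 \<partial>M)"
        using lim_tot_nonneg[OF i] by (intro nn_integral_cong_AE) (auto simp: ennreal_power)
      then show ?thesis using B(2)[OF i] by simp
    qed
    have int: "integrable M (\<lambda>\<omega>. lim_tot i \<omega> ^ 2)"
      using sq lim_tot_measurable[OF i]
      by (intro integrableI_nonneg) (auto intro: le_less_trans ennreal_less_top)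
    have "ennreal (expectation (\<lambda>\<omega>. lim_tot i \<omega> ^ 2)) \<le> ennreal B"
      using sq nn_integral_eq_integral[OF int] by simp
    then have sq': "expectation (\<lambda>\<omega>. lim_tot i \<omega> ^ 2) \<le> C" using B(1) C by (simp add: ennreal_le_iff)
    have I: "integrable M (indicator ?Z :: 'a \<Rightarrow> real)"
      using Z by (intro integrable_real_indicator) (simp_all add: less_top[symmetric])
    have linear: "expectation (\<lambda>\<omega>. a * f \<omega> + b * (1 - g \<omega>)) = a * expectation f + b * (1 - expectation g)"
      if "integrable M f" "integrable M g" for f g :: "'a \<Rightarrow> real" and a b
      using that by (simp add: prob_space)
    have "expectation (lim_tot i) \<le> expectation (\<lambda>\<omega>. (1 / (2 * C)) * lim_tot i \<omega> ^ 2 + (C / 2) * (1 - indicator ?Z \<omega>))"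
    proof (rule integral_mono)
      show "lim_tot i \<omega> \<le> (1 / (2 * C)) * lim_tot i \<omega> ^ 2 + (C / 2) * (1 - indicator ?Z \<omega>)"
        if "\<omega> \<in> space M" for \<omega>
      proof (cases "lim_tot i \<omega> = 0")
        case False
        then show ?thesis using abs_le_square_plus[of C "lim_tot i \<omega>"] C by simp
      qed (use that in simp)
    next
      show "integrable M (\<lambda>\<omega>. (1 / (2 * C)) * lim_tot i \<omega> ^ 2 + (C / 2) * (1 - indicator ?Z \<omega>))"
        by (intro Bochner_Integration.integrable_add integrable_mult_right Bochner_Integration.integrable_diff int integrable_const I)
    qed (rule lim_tot_mean(1)[OF i])
    also have "\<dots> = (1 / (2 * C)) * expectation (\<lambda>\<omega>. lim_tot i \<omega> ^ 2) + (C / 2) * (1 - prob ?Z)"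
      unfolding linear[OF int I] using Z by simp
    also have "\<dots> \<le> (1 / (2 * C)) * C + (C / 2) * (1 - prob ?Z)"
      using sq' C by (intro add_right_mono mult_left_mono) auto
    finally have "1 \<le> 1 / 2 + (C / 2) * (1 - prob ?Z)"
      using lim_tot_mean(2)[OF i] C by simp
    then have "1 / C \<le> 1 - prob ?Z" using C by (simp add: field_simps)
    then show ?thesis by simp
  qed
  moreover have "1 - 1 / C < 1" "0 \<le> 1 - 1 / C" using C by auto
  ultimately show ?thesis by blast
qed

text \<open>The limit at i vanishes only if both independent limits at i1 and i2 do, so a uniform bound on
  the probabilities of vanishing improves to its square.\<close>

lemma lim_tot_pos:
  assumes "i \<in> lists letters" shows "AE \<omega> in M. 0 < lim_tot i \<omega>"
proof -
  obtain \<theta> where \<theta>: "\<theta> < 1" "0 \<le> \<theta>" "\<And>i. i \<in> lists letters \<Longrightarrow> prob {\<omega> \<in> space M. lim_tot i \<omega> = 0} \<le> \<theta>"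
    using lim_tot_zero_less by blast
  let ?Z = "\<lambda>i. {\<omega> \<in> space M. lim_tot i \<omega> = 0}"
  have Z: "?Z i \<in> events" if "i \<in> lists letters" for i
    using lim_tot_measurable[OF that] by measurable
  have "prob (?Z i) \<le> \<theta> ^ Suc n" if "i \<in> lists letters" for i n
    using that
  proof (induction n arbitrary: i)
    case 0 then show ?case using \<theta>(3) by simp
  next
    case (Suc n)
      have il: "i @ [1] \<in> lists letters" "i @ [2] \<in> lists letters" using Suc.prems by auto
    let ?I = "\<lambda>k \<omega>. indicator (?Z (i @ [k])) \<omega> :: real"
    have m: "?I k \<in> borel_measurable (info (descendants (i @ [k])))" for k
    proof (rule borel_measurable_indicator)
      have "{\<omega> \<in> space (info (descendants (i @ [k]))). lim_tot (i @ [k]) \<omega> = 0} \<in> sets (info (descendants (i @ [k])))"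
        using lim_tot_measurable_info[of "i @ [k]"] by measurable
      then show "?Z (i @ [k]) \<in> sets (info (descendants (i @ [k])))" by simp
    qed
    have int: "integrable M (?I k)" if "i @ [k] \<in> lists letters" for k
      using Z[OF that] by (intro integrable_real_indicator) (simp_all add: less_top[symmetric])
    have one: "(\<lambda>_. 1) \<in> borel_measurable (info X)" "integrable M (\<lambda>_. 1::real)"
      "expectation (\<lambda>_. 1::real) = 1" for X
      by (simp_all add: prob_space)
    note I = branch_expectation[OF Suc.prems one(1) m m one(2) int[OF il(1)] int[OF il(2)]]
    have pos: "AE \<omega> in M. 0 < w (i @ [1]) \<omega>" "AE \<omega> in M. 0 < w (i @ [2]) \<omega>"
      using w_child(4)[OF Suc.prems, of 1] w_child(4)[OF Suc.prems, of 2] by simp_all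
    have "prob (?Z i) = expectation (indicator (?Z i))" using Z[OF Suc.prems] by simp
    also have "\<dots> \<le> expectation (\<lambda>\<omega>. 1 * (?I 1 \<omega> * ?I 2 \<omega>))"
    proof (rule integral_mono_AE[OF _ I(2)])
      show "AE \<omega> in M. indicator (?Z i) \<omega> \<le> 1 * (?I 1 \<omega> * ?I 2 \<omega>)"
        using lim_tot_step[OF Suc.prems] pos
          lim_tot_nonneg[OF il(1)] lim_tot_nonneg[OF il(2)]
      proof eventually_elim
        case (elim \<omega>)
        then show ?case
          by (auto simp: indicator_def add_nonneg_eq_0_iff)
      qed
      show "integrable M (indicator (?Z i) :: 'a \<Rightarrow> real)"
        using Z[OF Suc.prems] by (intro integrable_real_indicator) (simp_all add: less_top[symmetric])
    qed
    also have "\<dots> = prob (?Z (i @ [1])) * prob (?Z (i @ [2]))"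
      using I(1) Z[OF il(1)] Z[OF il(2)] unfolding one(3) by simp
    \<comment> \<open>One subtree takes the inductive bound and the other the uniform bound
      \<open>\<theta>\<close>, so each step gains a factor \<open>\<theta>\<close>.\<close>
    also have "\<dots> \<le> \<theta> ^ Suc n * \<theta>"
      using \<theta>(2) by (intro mult_mono Suc.IH[OF il(1)] \<theta>(3)[OF il(2)]) auto
    finally show ?case by (simp add: mult.commute)
  qed
  moreover have "(\<lambda>n. \<theta> ^ Suc n) \<longlonglongrightarrow> 0"
    using \<theta> by (intro LIMSEQ_Suc LIMSEQ_realpow_zero)
  ultimately have "prob (?Z i) \<le> 0"
    using assms by (intro LIMSEQ_le_const[of "\<lambda>n. \<theta> ^ Suc n"]) auto
  then have "prob (?Z i) = 0" using measure_nonneg[of M "?Z i"] by linarith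
  then have "AE \<omega> in M. lim_tot i \<omega> \<noteq> 0"
    using Z[OF assms] prob_eq_0[OF Z[OF assms]] AE_space by auto
  then show ?thesis
    using lim_tot_nonneg[OF assms] by eventually_elim simp
qed

end

section \<open>Decay of the edge lengths\<close>

context cascade begin

lemma power_sum_measurable_info:
  "(\<lambda>\<omega>. power_sum (\<lambda>i. w i \<omega>) p n i) \<in> borel_measurable (info (descendants i))"
proof (induction n arbitrary: i)
  case 0 then show ?case using lim_tot_measurable_info[of i] by simp
next
  case (Suc n)
  have "(\<lambda>\<omega>. ennreal (w (i @ [k]) \<omega> ^ p) * power_sum (\<lambda>i. w i \<omega>) p n (i @ [k]))
      \<in> borel_measurable (info (descendants i))" if k: "k \<in> letters" for k
  proof -
    note [measurable] = info_w[OF descendants_self k, of i] info_mono[OF descendants_snoc[OF k] Suc.IH, of i]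
    show ?thesis by measurable
  qed
  then show ?case unfolding power_sum.simps by (rule borel_measurable_sum)
qed

definition child_power :: "nat \<Rightarrow> real" where
  "child_power p = (\<Sum>k\<in>letters. expectation (\<lambda>\<omega>. w [k] \<omega> ^ p))"

lemma root_child:
  assumes "k \<in> letters"
  shows "w [k] \<in> borel_measurable M" "\<omega> \<in> space M \<Longrightarrow> 0 \<le> w [k] \<omega>" "\<omega> \<in> space M \<Longrightarrow> w [k] \<omega> \<le> 1"
  using w_child[of "[]" k] assms by simp_all

lemma child_power_nonneg: "0 \<le> expectation (\<lambda>\<omega>. w [k] \<omega> ^ p)" if "k \<in> letters"
  by (intro integral_nonneg_AE AE_I2 zero_le_power root_child(2)[OF that])

text \<open>The triple at \<open>i\<close> is independent of what lies below, so each level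
  contributes the factor \<open>child_power p\<close>; the three children enter additively, so
  dependence among them does no harm. The factor \<open>B\<close> stands for the limit at the end of
  a word.\<close>

lemma power_sum_mean:
  assumes B: "0 \<le> B" "\<And>i. i \<in> lists letters \<Longrightarrow> (\<integral>\<^sup>+\<omega>. ennreal (lim_tot i \<omega>) ^ p \<partial>M) \<le> ennreal B"
  shows "i \<in> lists letters \<Longrightarrow> (\<integral>\<^sup>+\<omega>. power_sum (\<lambda>i. w i \<omega>) p n i \<partial>M) \<le> ennreal (child_power p ^ n * B)"
proof (induction n arbitrary: i)
  case 0 then show ?case using B by simp
next
  case (Suc n)
  let ?P = "\<lambda>k \<omega>. power_sum (\<lambda>i. w i \<omega>) p n (i @ [k])"
  have f: "(\<lambda>\<omega>. ennreal (w (i @ [k]) \<omega> ^ p)) \<in> borel_measurable (info {i})" if "k \<in> letters" for k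
    using info_w[of i "{i}" k] that by simp
  have m: "(\<lambda>\<omega>. ennreal (w (i @ [k]) \<omega> ^ p) * ?P k \<omega>) \<in> borel_measurable M" if k: "k \<in> letters" for k
  proof -
    have "(\<lambda>\<omega>. ennreal (w (i @ [k]) \<omega> ^ p)) \<in> borel_measurable M"
      using f[OF k] Suc.prems by (intro info_measurable[of "{i}"]) auto
    moreover have "?P k \<in> borel_measurable M"
      by (rule info_measurable[OF descendants_lists[OF snoc_lists[OF Suc.prems k]] power_sum_measurable_info])
    ultimately show ?thesis by measurable
  qed
  have nonneg: "0 \<le> child_power p ^ n * B"
    unfolding child_power_def using B(1) child_power_nonneg by (intro mult_nonneg_nonneg zero_le_power sum_nonneg)
  have "(\<integral>\<^sup>+\<omega>. power_sum (\<lambda>i. w i \<omega>) p (Suc n) i \<partial>M) =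
      (\<Sum>k\<in>letters. \<integral>\<^sup>+\<omega>. ennreal (w (i @ [k]) \<omega> ^ p) * ?P k \<omega> \<partial>M)"
    unfolding power_sum.simps by (rule nn_integral_sum[OF m])
  also have "\<dots> \<le> (\<Sum>k\<in>letters. ennreal (expectation (\<lambda>\<omega>. w [k] \<omega> ^ p) * (child_power p ^ n * B)))"
  proof (rule sum_mono)
    fix k assume k: "k \<in> letters"
    have "(\<integral>\<^sup>+\<omega>. ennreal (w (i @ [k]) \<omega> ^ p) * ?P k \<omega> \<partial>M) =
        ennreal (expectation (\<lambda>\<omega>. w [k] \<omega> ^ p)) * (\<integral>\<^sup>+\<omega>. ?P k \<omega> \<partial>M)"
      using branch_nn_integral[OF Suc.prems f[OF k] k power_sum_measurable_info] child_moment[OF Suc.prems k]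
      by simp
    also have "\<dots> \<le> ennreal (expectation (\<lambda>\<omega>. w [k] \<omega> ^ p)) * ennreal (child_power p ^ n * B)"
      by (intro mult_left_mono Suc.IH[OF snoc_lists[OF Suc.prems k]]) simp
    finally show "(\<integral>\<^sup>+\<omega>. ennreal (w (i @ [k]) \<omega> ^ p) * ?P k \<omega> \<partial>M) \<le>
        ennreal (expectation (\<lambda>\<omega>. w [k] \<omega> ^ p) * (child_power p ^ n * B))"
      using child_power_nonneg[OF k] nonneg by (simp add: ennreal_mult)
  qed
  also have "\<dots> = ennreal (\<Sum>k\<in>letters. expectation (\<lambda>\<omega>. w [k] \<omega> ^ p) * (child_power p ^ n * B))"
    using mult_nonneg_nonneg[OF child_power_nonneg nonneg] by (rule sum_ennreal)
  also have "\<dots> = ennreal (child_power p ^ Suc n * B)"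
    unfolding sum_distrib_right[symmetric] child_power_def[symmetric] by (simp add: mult.assoc)
  finally show ?case .
qed

text \<open>Dominated convergence: powers of a number in [0,1] tend to 1 if it equals 1 and to 0
  otherwise.\<close>

lemma child_power_less_1:
  assumes "(\<Sum>k\<in>letters. prob {\<omega> \<in> space M. w [k] \<omega> = 1}) < 1"
  shows "\<exists>p>0. child_power p < 1"
proof -
  have "(\<lambda>p. expectation (\<lambda>\<omega>. w [k] \<omega> ^ p)) \<longlonglongrightarrow> prob {\<omega> \<in> space M. w [k] \<omega> = 1}" if k: "k \<in> letters" for k
  proof -
    let ?I = "indicator {\<omega> \<in> space M. w [k] \<omega> = 1} :: 'a \<Rightarrow> real"
    note w = root_child[OF k]
    have I: "{\<omega> \<in> space M. w [k] \<omega> = 1} \<in> events" using w(1) by measurable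
    have "(\<lambda>p. expectation (\<lambda>\<omega>. w [k] \<omega> ^ p)) \<longlonglongrightarrow> expectation ?I"
    proof (rule integral_dominated_convergence[where w = "\<lambda>_. 1"])
      show "AE \<omega> in M. (\<lambda>p. w [k] \<omega> ^ p) \<longlonglongrightarrow> ?I \<omega>"
      proof (rule AE_I2)
        fix \<omega> assume \<omega>: "\<omega> \<in> space M"
        show "(\<lambda>p. w [k] \<omega> ^ p) \<longlonglongrightarrow> ?I \<omega>"
        proof (cases "w [k] \<omega> = 1")
          case False
          then have "w [k] \<omega> < 1" using w(3)[OF \<omega>] by simp
          then show ?thesis using False w(2)[OF \<omega>] by (simp add: LIMSEQ_realpow_zero)
        qed (use \<omega> in simp)
      qed
      show "AE \<omega> in M. norm (w [k] \<omega> ^ p) \<le> 1" for p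
        using w by (intro AE_I2) (simp add: power_abs power_le_one)
    qed (use w(1) I in auto)
    then show ?thesis using I by simp
  qed
  then have "child_power \<longlonglongrightarrow> (\<Sum>k\<in>letters. prob {\<omega> \<in> space M. w [k] \<omega> = 1})"
    unfolding child_power_def by (rule tendsto_sum)
  then have "\<forall>\<^sub>F p in sequentially. child_power p < 1" using assms by (rule order_tendstoD)
  then obtain N where "\<And>p. p \<ge> N \<Longrightarrow> child_power p < 1" by (auto simp: eventually_sequentially)
  \<comment> \<open>The successor keeps \<open>p\<close> positive, as a p-th root is taken
    later.\<close>
  then show ?thesis by (intro exI[of _ "Suc N"]) auto
qed

text \<open>Any ratio strictly between \<open>child_power p\<close> and 1 will do;
  \<open>\<mu>\<close> is the midpoint. Multiplied by \<open>(1 / \<mu>) ^ n\<close>, the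
  expectations still have a finite sum, so almost surely the series itself is finite, and its sum is
  the random constant \<open>C\<close>.\<close>

lemma power_sum_decay:
  assumes "(\<Sum>k\<in>letters. prob {\<omega> \<in> space M. w [k] \<omega> = 1}) < 1"
  obtains p \<mu> where "0 < p" "0 < \<mu>" "\<mu> < (1::real)"
    "AE \<omega> in M. \<exists>C. \<forall>n. power_sum (\<lambda>i. w i \<omega>) p n [] \<le> ennreal (C * \<mu> ^ n)"
proof -
  obtain p where p: "0 < p" "child_power p < 1" using child_power_less_1[OF assms] by blast
  obtain B where B: "0 \<le> B" "\<And>i. i \<in> lists letters \<Longrightarrow> (\<integral>\<^sup>+\<omega>. ennreal (lim_tot i \<omega>) ^ p \<partial>M) \<le> ennreal B"
    using lim_tot_moment_bounded[of p] by blast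
  have l0: "0 \<le> child_power p" unfolding child_power_def by (intro sum_nonneg child_power_nonneg)
  define \<mu> where "\<mu> = (child_power p + 1) / 2"
  have \<mu>: "0 < \<mu>" "\<mu> < 1" "child_power p < \<mu>" using p l0 by (auto simp: \<mu>_def)
  let ?P = "\<lambda>n \<omega>. power_sum (\<lambda>i. w i \<omega>) p n []"
  let ?f = "\<lambda>n \<omega>. ?P n \<omega> * ennreal ((1 / \<mu>) ^ n)"
  have P: "?P n \<in> borel_measurable M" for n
    by (rule info_measurable[OF descendants_lists power_sum_measurable_info]) simp
  then have f: "?f n \<in> borel_measurable M" for n by measurable
  have "(\<integral>\<^sup>+\<omega>. (\<Sum>n. ?f n \<omega>) \<partial>M) = (\<Sum>n. \<integral>\<^sup>+\<omega>. ?f n \<omega> \<partial>M)" by (rule nn_integral_suminf[OF f])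
  also have "\<dots> \<le> (\<Sum>n. ennreal (B * (child_power p / \<mu>) ^ n))"
  proof (rule suminf_le)
    fix n
    have "(\<integral>\<^sup>+\<omega>. ?f n \<omega> \<partial>M) = (\<integral>\<^sup>+\<omega>. ?P n \<omega> \<partial>M) * ennreal ((1 / \<mu>) ^ n)"
      by (rule nn_integral_multc[OF P])
    also have "\<dots> \<le> ennreal (child_power p ^ n * B) * ennreal ((1 / \<mu>) ^ n)"
      using power_sum_mean[OF B, of "[]" n] by (intro mult_right_mono) auto
    also have "\<dots> = ennreal (B * (child_power p / \<mu>) ^ n)"
      using l0 B(1) \<mu> by (simp add: ennreal_mult[symmetric] power_divide mult_ac)
    finally show "(\<integral>\<^sup>+\<omega>. ?f n \<omega> \<partial>M) \<le> ennreal (B * (child_power p / \<mu>) ^ n)" .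
  qed auto
  also have "\<dots> = ennreal (\<Sum>n. B * (child_power p / \<mu>) ^ n)"
    using l0 B(1) \<mu> by (intro suminf_ennreal2 summable_mult summable_geometric) auto
  also have "\<dots> < \<infinity>" by simp
  finally have "(\<integral>\<^sup>+\<omega>. (\<Sum>n. ?f n \<omega>) \<partial>M) \<noteq> \<infinity>" by simp
  then have "AE \<omega> in M. (\<Sum>n. ?f n \<omega>) \<noteq> \<infinity>"
    using f by (intro nn_integral_PInf_AE) auto
  then have "AE \<omega> in M. \<exists>C. \<forall>n. ?P n \<omega> \<le> ennreal (C * \<mu> ^ n)"
  proof eventually_elim
    case (elim \<omega>)
    then obtain C where C: "0 \<le> C" "(\<Sum>n. ?f n \<omega>) = ennreal C"
      by (cases "\<Sum>n. ?f n \<omega>" rule: ennreal_cases) auto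
    have "?P n \<omega> \<le> ennreal (C * \<mu> ^ n)" for n
    proof -
      have "?f n \<omega> \<le> (\<Sum>n. ?f n \<omega>)" using sum_le_suminf[of "\<lambda>n. ?f n \<omega>" "{n}"] by simp
      then have "?f n \<omega> * ennreal (\<mu> ^ n) \<le> ennreal C * ennreal (\<mu> ^ n)"
        unfolding C(2) by (intro mult_right_mono) auto
      moreover have "ennreal ((1 / \<mu>) ^ n) * ennreal (\<mu> ^ n) = 1"
        using \<mu> by (simp add: ennreal_mult[symmetric] power_mult_distrib[symmetric])
      ultimately show ?thesis using C(1) \<mu> by (simp add: mult.assoc ennreal_mult)
    qed
    then show ?case by blast
  qed
  then show ?thesis using that p(1) \<mu>(1,2) by blast
qed

end

section \<open>Edge lengths of one positive realisation\<close>

lemma edge_length_Nil [simp]: "edge_length v [] = 1"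
  by (simp add: edge_length_def)

lemma edge_length_snoc: "edge_length v (i @ [k]) = edge_length v i * v (i @ [k])"
proof -
  have "(\<Prod>m = 1..length i. v (take m (i @ [k]))) = (\<Prod>m = 1..length i. v (take m i))"
    by (intro prod.cong) auto
  then show ?thesis by (simp add: edge_length_def)
qed

lemma edge_length_pos:
  assumes "\<forall>j\<in>lists letters - {[]}. 0 < v j"
  shows "i \<in> lists letters \<Longrightarrow> 0 < edge_length v i"
proof (induction i rule: rev_induct)
  case (snoc k i) then show ?case using bspec[OF assms, of "i @ [k]"] by (simp add: edge_length_snoc)
qed simp

text \<open>Connects the quotients in \<open>cascade_limit\<close> with the recursion; positivity of
  the weights allows the common factor \<open>edge_length v i\<close> to be cancelled.\<close>

lemma sum_edge_length:
  assumes v: "\<forall>j\<in>lists letters - {[]}. 0 < v j"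
  shows "i \<in> lists letters \<Longrightarrow>
    (\<Sum>j\<in>words {1, 2} n. edge_length v (i @ j) / edge_length v i) = partial_mass v n i"
proof (induction n arbitrary: i)
  case 0 then show ?case using edge_length_pos[OF v, of i] by simp
next
  case (Suc n)
  have "(\<Sum>j\<in>words {1, 2} n. edge_length v (i @ k # j) / edge_length v i) =
      v (i @ [k]) * partial_mass v n (i @ [k])" if k: "k \<in> {1, 2}" for k
  proof -
    have ik: "i @ [k] \<in> lists letters" using Suc.prems k by auto
    have "(\<Sum>j\<in>words {1, 2} n. edge_length v (i @ k # j) / edge_length v i) =
        (\<Sum>j\<in>words {1, 2} n. v (i @ [k]) * (edge_length v ((i @ [k]) @ j) / edge_length v (i @ [k])))"
      using edge_length_pos[OF v Suc.prems] bspec[OF v, of "i @ [k]"] ik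
      by (intro sum.cong refl) (simp add: edge_length_snoc[of v i k])
    then show ?thesis unfolding sum_distrib_left[symmetric] Suc.IH[OF ik] .
  qed
  from this[of 1] this[of 2] show ?case unfolding sum_words_Suc by simp
qed

lemma cascade_limit_eq_mass:
  assumes "\<forall>j\<in>lists letters - {[]}. 0 < v j" "i \<in> lists letters"
  shows "cascade_limit v i = mass v i"
  unfolding cascade_limit_def mass_def using sum_edge_length[OF assms] by simp

text \<open>One edge is a single term of the sum over its level, so \<open>power_sum\<close> bounds
  all edges of a level at once. In the induction the prefix \<open>i\<close> takes over the letters
  removed from \<open>j\<close>.\<close>

lemma edge_power_le:
  assumes v: "\<forall>j\<in>lists letters - {[]}. 0 < v j"
  shows "i \<in> lists letters \<Longrightarrow> j \<in> lists letters \<Longrightarrow>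
    ennreal (edge_length v (i @ j) ^ p) * ennreal (mass v (i @ j)) ^ p
      \<le> ennreal (edge_length v i ^ p) * power_sum v p (length j) i"
proof (induction j arbitrary: i rule: list.induct)
  case (Cons k j)
  then have k: "k \<in> letters" "j \<in> lists letters" "i @ [k] \<in> lists letters" by auto
  have "ennreal (edge_length v (i @ k # j) ^ p) * ennreal (mass v (i @ k # j)) ^ p \<le>
      ennreal (edge_length v (i @ [k]) ^ p) * power_sum v p (length j) (i @ [k])"
    using Cons.IH[OF k(3,2)] by simp
  also have "\<dots> = ennreal (edge_length v i ^ p) * (ennreal (v (i @ [k]) ^ p) * power_sum v p (length j) (i @ [k]))"
    using edge_length_pos[OF v Cons.prems(1)] bspec[OF v, of "i @ [k]"] k(3)
    by (simp add: edge_length_snoc power_mult_distrib ennreal_mult mult.assoc)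
  also have "\<dots> \<le> ennreal (edge_length v i ^ p) * power_sum v p (length (k # j)) i"
    using member_le_sum[OF k(1), of "\<lambda>k. ennreal (v (i @ [k]) ^ p) * power_sum v p (length j) (i @ [k])"]
    by (intro mult_left_mono) simp_all
  finally show ?case .
qed simp

text \<open>Taking p-th roots replaces \<open>\<mu>\<close> by \<open>root p \<mu>\<close>. The
  constant \<open>max 1 C\<close> is at most its own p-th power, so it can stay as it is, and it
  covers a \<open>C\<close> of either sign.\<close>

lemma power_decay_imp_geometric:
  fixes x C \<mu> :: real
  assumes "0 < p" "0 \<le> x" "0 < \<mu>" "x ^ p \<le> C * \<mu> ^ n"
  shows "x \<le> max 1 C * root p \<mu> ^ n"
proof (rule power_le_imp_le_base)
  have "x ^ p \<le> max 1 C ^ p * \<mu> ^ n"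
  proof -
    have "C \<le> max 1 C ^ p"
      using self_le_power[of "max 1 C" p] assms(1) by simp
    then have "C * \<mu> ^ n \<le> max 1 C ^ p * \<mu> ^ n" using assms(3) by (intro mult_right_mono) auto
    then show ?thesis using assms(4) by linarith
  qed
  also have "\<dots> = (max 1 C * root p \<mu> ^ n) ^ p"
    using assms(1,3) by (simp add: power_mult_distrib power_mult[symmetric] mult.commute[of n])
      (simp add: power_mult real_root_pow_pos2)
  finally show "x ^ Suc (p - 1) \<le> (max 1 C * root p \<mu> ^ n) ^ Suc (p - 1)" using assms(1) by simp
qed (use assms in auto)

lemma AE_ball_countable_type:
  fixes P :: "'a \<Rightarrow> 'i::countable \<Rightarrow> bool"
  assumes "\<And>i. i \<in> A \<Longrightarrow> AE \<omega> in M. P \<omega> i"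
  shows "AE \<omega> in M. \<forall>i\<in>A. P \<omega> i"
  using assms by (subst AE_ball_countable) auto

theorem theorem3:
  fixes c :: real and T :: "(real \<times> real) set"
    and M :: "'a measure" and w :: "nat list \<Rightarrow> 'a \<Rightarrow> real"
  assumes "0 < c" and "c < 1 / 2"
    and "compact T" and "T \<noteq> {}" and "T = (\<Union>i \<in> letters. psi c i ` T)"
    and "prob_space M"
    and "\<And>i. i \<in> lists letters - {[]} \<Longrightarrow> w i \<in> borel_measurable M"
    and "\<And>i \<omega>. i \<in> lists letters - {[]} \<Longrightarrow> \<omega> \<in> space M \<Longrightarrow> w i \<omega> \<in> {0..1}"
    and "\<And>i. i \<in> lists letters - {[]} \<Longrightarrow> AE \<omega> in M. w i \<omega> \<noteq> 0"
    and "prob_space.indep_vars M (\<lambda>_. borel)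
           (\<lambda>i \<omega>. (w (i @ [1]) \<omega>, w (i @ [2]) \<omega>, w (i @ [3]) \<omega>)) (lists letters)"
    and "\<And>i. i \<in> lists letters \<Longrightarrow>
           distr M borel (\<lambda>\<omega>. (w (i @ [1]) \<omega>, w (i @ [2]) \<omega>, w (i @ [3]) \<omega>))
           = distr M borel (\<lambda>\<omega>. (w [1] \<omega>, w [2] \<omega>, w [3] \<omega>))"
    and "prob_space.expectation M (\<lambda>\<omega>. w [1] \<omega> + w [2] \<omega>) = 1"
    and "(\<Sum>i \<in> letters. prob_space.prob M {\<omega> \<in> space M. w [i] \<omega> = 1}) < 1"
  shows "AE \<omega> in M.
    (\<forall>x \<in> T. \<forall>y \<in> T. \<exists>!r. is_resistance_limit c (\<lambda>i. w i \<omega>) x y r)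
    \<and> Metric_space T (limit_resistance c (\<lambda>i. w i \<omega>) T)
    \<and> Metric_space.mtopology T (limit_resistance c (\<lambda>i. w i \<omega>) T) = top_of_set T"
proof -
  interpret dendrite c using assms(1,2) by unfold_locales
  interpret prob_space M by (rule assms(6))
  interpret cascade M w
    by unfold_locales (rule assms; assumption)+
  obtain p \<mu> where p: "0 < p" and \<mu>: "0 < \<mu>" "\<mu> < 1"
    and decay: "AE \<omega> in M. \<exists>C. \<forall>n. power_sum (\<lambda>i. w i \<omega>) p n [] \<le> ennreal (C * \<mu> ^ n)"
    using power_sum_decay[OF assms(13)] by blast
  have pos: "AE \<omega> in M. \<forall>i\<in>lists letters. 0 < lim_tot i \<omega>"
    by (rule AE_ball_countable_type[OF lim_tot_pos])
  have step: "AE \<omega> in M. \<forall>i\<in>lists letters. lim_tot i \<omega> =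
      w (i @ [1]) \<omega> * lim_tot (i @ [1]) \<omega> + w (i @ [2]) \<omega> * lim_tot (i @ [2]) \<omega>"
    by (rule AE_ball_countable_type[OF lim_tot_step])
  have nonzero: "AE \<omega> in M. \<forall>i\<in>lists letters - {[]}. w i \<omega> \<noteq> 0"
    by (rule AE_ball_countable_type[OF assms(9)])
  show ?thesis
    \<comment> \<open>Words are countable, so one null set serves all addresses; outside it the
      argument is deterministic.\<close>
    using decay pos step nonzero AE_space
  proof eventually_elim
    case (elim \<omega>)
    define v where "v i = w i \<omega>" for i
    obtain C where C: "\<And>n. power_sum v p n [] \<le> ennreal (C * \<mu> ^ n)"
      using elim(1) unfolding v_def by blast
    have v: "\<forall>j\<in>lists letters - {[]}. 0 < v j"
    proof
      fix j assume j: "j \<in> lists letters - {[]}"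
      then have "v j \<noteq> 0" "v j \<in> {0..1}"
        using elim(4) assms(8)[OF j elim(5)] by (auto simp: v_def)
      then show "0 < v j" by simp
    qed
    have mass: "0 < mass v i"
      "mass v i = v (i @ [1]) * mass v (i @ [1]) + v (i @ [2]) * mass v (i @ [2])"
      if "i \<in> lists letters" for i
      using bspec[OF elim(2) that] bspec[OF elim(3) that] unfolding v_def .
    have weight: "edge_length v i * cascade_limit v i = edge_length v i * mass v i"
      if "i \<in> lists letters" for i
      using cascade_limit_eq_mass[OF v that] by simp
    have "consistent (\<lambda>i. edge_length v i * cascade_limit v i)"
      unfolding consistent_def
    proof (intro ballI conjI)
      fix i assume i: "i \<in> lists letters"
      have i12: "i @ [1] \<in> lists letters" "i @ [2] \<in> lists letters" using i by auto
      show "0 < edge_length v i * cascade_limit v i"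
        unfolding weight[OF i] by (intro mult_pos_pos edge_length_pos[OF v i] mass(1)[OF i])
      show "edge_length v i * cascade_limit v i = edge_length v (i @ [1]) * cascade_limit v (i @ [1]) +
          edge_length v (i @ [2]) * cascade_limit v (i @ [2])"
        unfolding weight[OF i] weight[OF i12(1)] weight[OF i12(2)]
        unfolding edge_length_snoc
        by (subst mass(2)[OF i]) (simp add: algebra_simps)
    qed
    moreover have "edge_length v i * cascade_limit v i \<le> max 1 C * root p \<mu> ^ length i"
      if i: "i \<in> lists letters" for i
    proof (rule power_decay_imp_geometric[OF p _ \<mu>(1)])
      let ?x = "edge_length v i * cascade_limit v i"
      have x: "0 < ?x"
        unfolding weight[OF i] by (intro mult_pos_pos edge_length_pos[OF v i] mass(1)[OF i])
      then show "0 \<le> ?x" by simp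
      have "ennreal (?x ^ p) = ennreal (edge_length v i ^ p) * ennreal (mass v i) ^ p"
        unfolding weight[OF i] power_mult_distrib
        using edge_length_pos[OF v i] mass(1)[OF i] by (simp add: ennreal_mult ennreal_power)
      also have "\<dots> \<le> power_sum v p (length i) []"
        using edge_power_le[OF v, of "[]" i p] i by simp
      also have "\<dots> \<le> ennreal (C * \<mu> ^ length i)" by (rule C)
      finally show "?x ^ p \<le> C * \<mu> ^ length i"
        \<comment> \<open>The sign of \<open>C\<close> is unknown; a positive left-hand side
          excludes that \<open>ennreal\<close> has truncated the right-hand side to 0.\<close>
        using zero_less_power[OF x, of p] by (auto simp: ennreal_le_iff2)
    qed
    moreover have "summable (\<lambda>n. max 1 C * root p \<mu> ^ n)"
      using p \<mu> by (intro summable_mult summable_geometric) simp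
    ultimately interpret weighted_dendrite c v "\<lambda>n. max 1 C * root p \<mu> ^ n"
      by unfold_locales
    show ?case
      using resistance_limit_metric[OF assms(3) attractor_eq_closure[OF assms(3-5)]]
      unfolding v_def .
  qed
qed

end
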